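(* Let $K$ be an algebraically closed field of characteristic zero and let $G$ be a cyclic subgroup of $Aut(C)$, where $C\subset\mathbb{P}^2(K)$ is a non-singular plane curve of degree $d\geq 4$. Then $|G|$ must divide one of the integers $d-1$, $d$, $d^2-3d+3$, $(d-1)^2$, $d(d-2)$, $d(d-1)$. In particular, $|G|\leq d(d-1)$.
   Context: $Aut(C)$ is the full automorphism group of $C$ over $K$, identified with the finite subgroup of $PGL_3(K)$ preserving the defining equation of $C$. *)

theory Defs
  imports
    "HOL-Analysis.Cartesian_Space"
    "HOL-Library.Poly_Mapping"
    "HOL-Computational_Algebra.Polynomial"
    "HOL-Algebra.Elementary_Groups"
begin

section \<open>Ternary polynomials\<close>

text \<open>
  A polynomial in three variables, indexed by the elements of the type \<^typ>\<open>3\<close>, is a finitely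
  supported map from exponent vectors to coefficients.
\<close>

type_synonym 'a poly3 = "(3 \<Rightarrow>\<^sub>0 nat) \<Rightarrow>\<^sub>0 'a"

definition const3 :: "'a::zero \<Rightarrow> 'a poly3" where
  "const3 c = Poly_Mapping.single 0 c"

definition var3 :: "3 \<Rightarrow> 'a::zero_neq_one poly3" where
  "var3 i = Poly_Mapping.single (Poly_Mapping.single i 1) 1"

definition homogeneous3 :: "nat \<Rightarrow> 'a::zero poly3 \<Rightarrow> bool" where
  "homogeneous3 d F \<longleftrightarrow>
     (\<forall>m \<in> Poly_Mapping.keys F. (\<Sum>i\<in>UNIV. Poly_Mapping.lookup m i) = d)"

definition eval3 :: "'a::comm_semiring_1 poly3 \<Rightarrow> 'a^3 \<Rightarrow> 'a" where
  "eval3 F v = (\<Sum>m \<in> Poly_Mapping.keys F.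
     Poly_Mapping.lookup F m * (\<Prod>i\<in>UNIV. (v $ i) ^ Poly_Mapping.lookup m i))"

text \<open>
  The formal partial derivative.  The exponent subtraction is truncated, but where it matters the
  coefficient is zero.
\<close>

definition pderiv3 :: "3 \<Rightarrow> 'a::comm_semiring_1 poly3 \<Rightarrow> 'a poly3" where
  "pderiv3 i F = (\<Sum>m \<in> Poly_Mapping.keys F.
     Poly_Mapping.single (m - Poly_Mapping.single i 1)
       (of_nat (Poly_Mapping.lookup m i) * Poly_Mapping.lookup F m))"

text \<open>The linear change of variables \<open>F(X) \<mapsto> F(A X)\<close>.\<close>

definition lin_subst3 :: "'a::comm_semiring_1^3^3 \<Rightarrow> 'a poly3 \<Rightarrow> 'a poly3" where
  "lin_subst3 A F = (\<Sum>m \<in> Poly_Mapping.keys F. const3 (Poly_Mapping.lookup F m) *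
     (\<Prod>i\<in>UNIV. (\<Sum>j\<in>UNIV. const3 (A $ i $ j) * var3 j) ^ Poly_Mapping.lookup m i))"


section \<open>Non-singular plane curves\<close>

text \<open>
  Points of the projective plane are represented by their non-zero coordinate vectors.
\<close>

definition singular_at :: "'a::field poly3 \<Rightarrow> 'a^3 \<Rightarrow> bool" where
  "singular_at F v \<longleftrightarrow> eval3 F v = 0 \<and> (\<forall>i. eval3 (pderiv3 i F) v = 0)"

text \<open>
  \<open>F\<close> is a defining equation of a non-singular plane curve of degree \<open>d\<close>.  Over an algebraically
  closed field, for \<open>d > 0\<close>, this forces \<open>F\<close> to be irreducible.
\<close>

definition nonsingular_plane_curve :: "nat \<Rightarrow> 'a::field poly3 \<Rightarrow> bool" where
  "nonsingular_plane_curve d F \<longleftrightarrow>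
     F \<noteq> 0 \<and> homogeneous3 d F \<and> (\<forall>v. v \<noteq> 0 \<longrightarrow> \<not> singular_at F v)"


section \<open>The projective linear group and the automorphism group\<close>

definition GL3 :: "('a::field^3^3) monoid" where
  "GL3 = \<lparr>carrier = {A. invertible A}, monoid.mult = (**), one = mat 1\<rparr>"

definition scalars3 :: "('a::field^3^3) set" where
  "scalars3 = {mat c | c. c \<noteq> 0}"

definition PGL3 :: "('a::field^3^3) set monoid" where
  "PGL3 = GL3 Mod scalars3"

text \<open>
  \<open>preserves A F\<close>: the map \<open>v \<mapsto> A v\<close> preserves the equation \<open>F = 0\<close>, that is, it fixes \<open>F\<close> up to
  a non-zero constant.
\<close>

definition preserves :: "'a::field^3^3 \<Rightarrow> 'a poly3 \<Rightarrow> bool" where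
  "preserves A F \<longleftrightarrow> (\<exists>c. c \<noteq> 0 \<and> lin_subst3 A F = const3 c * F)"

definition Aut :: "'a::field poly3 \<Rightarrow> ('a^3^3) set monoid" where
  "Aut F = PGL3\<lparr>carrier := {g \<in> carrier PGL3. \<exists>A\<in>g. preserves A F}\<rparr>"


section \<open>These are groups\<close>

lemma group_GL3: "group (GL3 :: ('a::field^3^3) monoid)"
proof (rule groupI)
  fix A :: "'a^3^3" assume "A \<in> carrier GL3"
  then obtain B where "A ** B = mat 1" "B ** A = mat 1"
    by (auto simp: GL3_def invertible_def)
  then show "\<exists>B\<in>carrier GL3. B \<otimes>\<^bsub>GL3\<^esub> A = \<one>\<^bsub>GL3\<^esub>"
    by (auto simp: GL3_def invertible_def intro!: bexI[of _ B])
next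
  show "\<one>\<^bsub>GL3\<^esub> \<in> carrier (GL3 :: ('a^3^3) monoid)"
    by (auto simp: GL3_def invertible_def intro: exI[of _ "mat 1"])
qed (auto simp: GL3_def invertible_mult matrix_mul_assoc)

lemma mat_mult_entry:
  fixes A :: "'a::field^3^3"
  shows "(mat c ** A) $ i $ j = c * A $ i $ j" "(A ** mat c) $ i $ j = A $ i $ j * c"
  by (auto simp: matrix_matrix_mult_def mat_def if_distrib if_distribR cong: if_cong)

lemma mat_commute:
  fixes A :: "'a::field^3^3"
  shows "mat c ** A = A ** mat c"
  by (simp add: vec_eq_iff mat_mult_entry mult.commute)

lemma mat_mult_mat: "mat c ** mat d = (mat (c * d) :: 'a::field^3^3)"
  by (simp add: vec_eq_iff mat_mult_entry) (simp add: mat_def)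

lemma scalars3_subgroup: "subgroup scalars3 (GL3 :: ('a::field^3^3) monoid)"
proof -
  interpret group "GL3 :: ('a^3^3) monoid" by (rule group_GL3)
  have inv: "invertible (mat c :: 'a^3^3)" if "c \<noteq> 0" for c
    unfolding invertible_def using that by (intro exI[of _ "mat (inverse c)"]) (simp add: mat_mult_mat)
  show ?thesis
  proof (rule subgroupI)
    show "scalars3 \<subseteq> carrier (GL3 :: ('a^3^3) monoid)"
      using inv by (auto simp: scalars3_def GL3_def)
    show "scalars3 \<noteq> ({} :: ('a^3^3) set)"
      by (auto simp: scalars3_def intro: exI[of _ 1])
  next
    fix A :: "'a^3^3" assume "A \<in> scalars3"
    then obtain c where c: "A = mat c" "c \<noteq> 0" by (auto simp: scalars3_def)
    have "inv\<^bsub>GL3\<^esub> A = mat (inverse c)"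
      by (rule inv_equality) (use c inv in \<open>auto simp: GL3_def mat_mult_mat\<close>)
    then show "inv\<^bsub>GL3\<^esub> A \<in> scalars3"
      using c by (auto simp: scalars3_def intro!: exI[of _ "inverse c"])
  next
    fix A B :: "'a^3^3" assume "A \<in> scalars3" "B \<in> scalars3"
    then show "A \<otimes>\<^bsub>GL3\<^esub> B \<in> scalars3"
      by (auto simp: scalars3_def GL3_def mat_mult_mat)
  qed
qed

lemma scalars3_normal: "scalars3 \<lhd> (GL3 :: ('a::field^3^3) monoid)"
proof (rule group.normalI[OF group_GL3 scalars3_subgroup], rule ballI)
  fix A :: "'a^3^3"
  show "scalars3 #>\<^bsub>GL3\<^esub> A = A <#\<^bsub>GL3\<^esub> scalars3"
    by (auto simp: r_coset_def l_coset_def scalars3_def GL3_def mat_commute)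
qed

lemma group_PGL3: "group (PGL3 :: ('a::field^3^3) set monoid)"
  unfolding PGL3_def by (rule normal.factorgroup_is_group[OF scalars3_normal])

lemma poly3_decomp: "F = (\<Sum>m \<in> Poly_Mapping.keys F. Poly_Mapping.single m (Poly_Mapping.lookup F m))"
  by (rule poly_mapping_eqI)
     (auto simp: Poly_Mapping.lookup_sum lookup_single when_def in_keys_iff if_distrib sum.delta' cong: if_cong)

lemma lin_subst3_add: "lin_subst3 A (F + G) = lin_subst3 A F + lin_subst3 A G"
  unfolding lin_subst3_def
  by (rule setsum_keys_plus_distrib) (auto simp: const3_def single_add distrib_right)

lemma lin_subst3_zero [simp]: "lin_subst3 A 0 = 0"
  by (simp add: lin_subst3_def)

lemma lin_subst3_sum: "lin_subst3 A (sum f S) = (\<Sum>x\<in>S. lin_subst3 A (f x))"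
  by (induction S rule: infinite_finite_induct) (auto simp: lin_subst3_add)

lemma lin_subst3_single:
  "lin_subst3 A (Poly_Mapping.single m c) =
     const3 c * (\<Prod>i\<in>UNIV. (\<Sum>j\<in>UNIV. const3 (A $ i $ j) * var3 j) ^ Poly_Mapping.lookup m i)"
  by (simp add: lin_subst3_def const3_def)

lemma lin_subst3_mult: "lin_subst3 A (F * G) = lin_subst3 A F * lin_subst3 A G"
proof -
  have s: "lin_subst3 A (Poly_Mapping.single m a * Poly_Mapping.single n b) =
      lin_subst3 A (Poly_Mapping.single m a) * lin_subst3 A (Poly_Mapping.single n b)" for m n a b
    unfolding mult_single lin_subst3_single
    by (simp add: const3_def lookup_add power_add prod.distrib mult_ac
          flip: mult_single[of 0 _ 0, simplified])
  have "F * G = (\<Sum>m \<in> Poly_Mapping.keys F. \<Sum>n \<in> Poly_Mapping.keys G.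
      Poly_Mapping.single m (Poly_Mapping.lookup F m) * Poly_Mapping.single n (Poly_Mapping.lookup G n))"
    unfolding sum_product[symmetric] poly3_decomp[symmetric] ..
  then have "lin_subst3 A (F * G) =
      lin_subst3 A (\<Sum>m \<in> Poly_Mapping.keys F. Poly_Mapping.single m (Poly_Mapping.lookup F m)) *
      lin_subst3 A (\<Sum>n \<in> Poly_Mapping.keys G. Poly_Mapping.single n (Poly_Mapping.lookup G n))"
    by (simp only: lin_subst3_sum s sum_product)
  then show ?thesis
    by (simp only: poly3_decomp[symmetric])
qed

lemma lin_subst3_const [simp]: "lin_subst3 A (const3 c) = const3 c"
  by (simp add: const3_def lin_subst3_single[unfolded const3_def])

lemma lin_subst3_one [simp]: "lin_subst3 A 1 = 1"
  using lin_subst3_const[of A 1] by (simp add: const3_def)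

lemma lin_subst3_power: "lin_subst3 A (F ^ n) = lin_subst3 A F ^ n"
  by (induction n) (auto simp: lin_subst3_mult)

lemma lin_subst3_prod: "lin_subst3 A (prod f S) = (\<Prod>x\<in>S. lin_subst3 A (f x))"
  by (induction S rule: infinite_finite_induct) (auto simp: lin_subst3_mult)

lemma lin_subst3_var: "lin_subst3 A (var3 i) = (\<Sum>j\<in>UNIV. const3 (A $ i $ j) * var3 j)"
proof -
  have "(\<Prod>k\<in>UNIV. (\<Sum>j\<in>UNIV. const3 (A $ k $ j) * var3 j) ^ Poly_Mapping.lookup (Poly_Mapping.single i (1::nat)) k)
      = (\<Prod>k\<in>UNIV. if k = i then (\<Sum>j\<in>UNIV. const3 (A $ k $ j) * var3 j) else 1)"
    by (rule prod.cong) (auto simp: lookup_single when_def)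
  then show ?thesis
    by (simp add: var3_def lin_subst3_single) (simp add: const3_def)
qed

lemma lin_subst3_lin_subst3: "lin_subst3 A (lin_subst3 B F) = lin_subst3 (B ** A) F"
proof -
  have c: "const3 (\<Sum>x\<in>S. f x) = (\<Sum>x\<in>S. const3 (f x))" for f :: "3 \<Rightarrow> 'a" and S
    by (induction S rule: infinite_finite_induct) (auto simp: const3_def single_add)
  have m: "const3 (x * y) = const3 x * const3 y" for x y :: 'a
    by (simp add: const3_def mult_single)
  have "(\<Sum>j\<in>UNIV. const3 (B $ i $ j) * (\<Sum>k\<in>UNIV. const3 (A $ j $ k) * var3 k))
      = (\<Sum>k\<in>UNIV. const3 ((B ** A) $ i $ k) * var3 k)" for i
    unfolding matrix_matrix_mult_def
    by (simp add: c m sum_distrib_left sum_distrib_right mult_ac) (rule sum.swap)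
  then show ?thesis
    by (subst (2) lin_subst3_def)
       (simp add: lin_subst3_sum lin_subst3_mult lin_subst3_prod lin_subst3_power lin_subst3_var
          lin_subst3_def[of "B ** A"])
qed

lemma lin_subst3_mat:
  fixes F :: "'a::field poly3"
  assumes "homogeneous3 d F"
  shows "lin_subst3 (mat c) F = const3 (c ^ d) * F"
proof -
  have pw: "Poly_Mapping.single k (a::'a) ^ n = Poly_Mapping.single (of_nat n * k) (a ^ n)"
    for k :: "3 \<Rightarrow>\<^sub>0 nat" and a n
    by (induction n) (auto simp: mult_single distrib_right)
  have l: "(\<Sum>j\<in>UNIV. const3 ((mat c :: 'a^3^3) $ i $ j) * var3 j) = Poly_Mapping.single (Poly_Mapping.single i 1) c" for i
  proof -
    have "(\<Sum>j\<in>UNIV. const3 ((mat c :: 'a^3^3) $ i $ j) * var3 j)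
        = (\<Sum>j\<in>UNIV. if i = j then Poly_Mapping.single (Poly_Mapping.single i 1) c else 0)"
      by (rule sum.cong) (auto simp: mat_def const3_def var3_def mult_single)
    then show ?thesis by simp
  qed
  have "(\<Prod>i\<in>UNIV. Poly_Mapping.single (Poly_Mapping.single i 1) c ^ Poly_Mapping.lookup m i)
      = Poly_Mapping.single m (c ^ (\<Sum>i\<in>UNIV. Poly_Mapping.lookup m i))" for m :: "3 \<Rightarrow>\<^sub>0 nat"
  proof -
    have e: "of_nat n * Poly_Mapping.single i 1 = Poly_Mapping.single i (n::nat)" for n and i :: 3
      by (induction n) (auto simp: distrib_right simp flip: single_add)
    have p: "(\<Prod>i\<in>S. Poly_Mapping.single (f i) (g i)) = Poly_Mapping.single (sum f S) (prod g S)"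
      for S and f :: "3 \<Rightarrow> 3 \<Rightarrow>\<^sub>0 nat" and g :: "3 \<Rightarrow> 'a"
      by (induction S rule: infinite_finite_induct) (auto simp: mult_single)
    have "(\<Sum>i\<in>UNIV. Poly_Mapping.single i (Poly_Mapping.lookup m i)) = m"
      by (rule poly_mapping_eqI) (auto simp: Poly_Mapping.lookup_sum lookup_single when_def)
    then show ?thesis by (simp only: pw e p power_sum)
  qed
  then have "lin_subst3 (mat c) F =
      (\<Sum>m \<in> Poly_Mapping.keys F. const3 (c ^ d) * Poly_Mapping.single m (Poly_Mapping.lookup F m))"
    unfolding lin_subst3_def l using assms
    by (intro sum.cong) (auto simp: homogeneous3_def const3_def mult_single mult.commute)
  also have "\<dots> = const3 (c ^ d) * F"
    by (subst (3) poly3_decomp[of F]) (simp only: sum_distrib_left)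
  finally show ?thesis .
qed

lemma preserves_one: "homogeneous3 d F \<Longrightarrow> preserves (mat 1) F"
  using lin_subst3_mat[of d F 1] by (auto simp: preserves_def intro!: exI[of _ 1])

lemma preserves_mult:
  assumes "preserves A F" "preserves B F"
  shows "preserves (A ** B) F"
proof -
  obtain a b where ab: "a \<noteq> 0" "b \<noteq> 0"
    "lin_subst3 A F = const3 a * F" "lin_subst3 B F = const3 b * F"
    using assms by (auto simp: preserves_def)
  have "lin_subst3 (A ** B) F = const3 a * (const3 b * F)"
    by (simp add: ab lin_subst3_mult flip: lin_subst3_lin_subst3)
  also have "\<dots> = const3 (a * b) * F"
    by (simp add: const3_def mult_single flip: mult.assoc)
  finally show ?thesis
    using ab by (auto simp: preserves_def intro!: exI[of _ "a * b"])
qed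

lemma preserves_inverse:
  assumes "homogeneous3 d F" "preserves A F" "A ** B = mat 1"
  shows "preserves B F"
proof -
  obtain a where a: "a \<noteq> 0" "lin_subst3 A F = const3 a * F"
    using assms by (auto simp: preserves_def)
  have "const3 a * lin_subst3 B F = lin_subst3 (A ** B) F"
    by (simp add: a lin_subst3_mult flip: lin_subst3_lin_subst3)
  also have "\<dots> = F"
    using lin_subst3_mat[OF assms(1), of 1] assms(3) by (simp add: const3_def)
  finally have "const3 (inverse a) * (const3 a * lin_subst3 B F) = const3 (inverse a) * F"
    by simp
  then have "lin_subst3 B F = const3 (inverse a) * F"
    using a by (simp add: const3_def mult_single flip: mult.assoc)
  then show ?thesis
    using a by (auto simp: preserves_def intro!: exI[of _ "inverse a"])
qed

lemma subgroup_Aut: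
  fixes F :: "'a::field poly3"
  assumes F: "homogeneous3 d F"
  shows "subgroup (carrier (Aut F)) PGL3"
proof -
  interpret GL: group "GL3 :: ('a^3^3) monoid" by (rule group_GL3)
  interpret N: normal scalars3 "GL3 :: ('a^3^3) monoid" by (rule scalars3_normal)
  interpret PGL: group "PGL3 :: ('a^3^3) set monoid" by (rule group_PGL3)
  show ?thesis
  proof (rule PGL.subgroupI)
    show "carrier (Aut F) \<subseteq> carrier PGL3" by (auto simp: Aut_def)
    have "\<one>\<^bsub>PGL3\<^esub> = (scalars3 :: ('a^3^3) set)" by (simp add: PGL3_def FactGroup_def)
    moreover have "mat 1 \<in> (scalars3 :: ('a^3^3) set)" by (auto simp: scalars3_def)
    ultimately have "\<one>\<^bsub>PGL3\<^esub> \<in> carrier (Aut F)"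
      using preserves_one[OF F] PGL.one_closed unfolding Aut_def by auto
    then show "carrier (Aut F) \<noteq> {}" by blast
  next
    fix g assume "g \<in> carrier (Aut F)"
    then obtain A where g: "g \<in> carrier PGL3" "A \<in> g" "preserves A F" by (auto simp: Aut_def)
    have "inv\<^bsub>PGL3\<^esub> g = set_inv\<^bsub>GL3\<^esub> g"
      using g by (simp add: PGL3_def N.inv_FactGroup)
    then have 1: "inv\<^bsub>GL3\<^esub> A \<in> inv\<^bsub>PGL3\<^esub> g" using g by (auto simp: SET_INV_def)
    have "A \<in> carrier GL3"
      using g N.rcosets_carrier[OF GL.is_group] by (auto simp: PGL3_def FactGroup_def)
    then have "preserves (inv\<^bsub>GL3\<^esub> A) F"
      using preserves_inverse[OF F g(3)] GL.r_inv[of A] by (simp add: GL3_def)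
    then show "inv\<^bsub>PGL3\<^esub> g \<in> carrier (Aut F)"
      using 1 g PGL.inv_closed by (auto simp: Aut_def)
  next
    fix g h assume "g \<in> carrier (Aut F)" "h \<in> carrier (Aut F)"
    then obtain A B where gh: "g \<in> carrier PGL3" "h \<in> carrier PGL3" "A \<in> g" "B \<in> h"
      "preserves A F" "preserves B F" by (auto simp: Aut_def)
    then have "A ** B \<in> g \<otimes>\<^bsub>PGL3\<^esub> h"
      by (auto simp: PGL3_def FactGroup_def set_mult_def GL3_def)
    then show "g \<otimes>\<^bsub>PGL3\<^esub> h \<in> carrier (Aut F)"
      using gh preserves_mult PGL.m_closed unfolding Aut_def by fastforce
  qed
qed

lemma group_Aut: "homogeneous3 d F \<Longrightarrow> group (Aut F)"
  using subgroup.subgroup_is_group[OF subgroup_Aut group_PGL3] by (simp add: Aut_def)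

end

theory Submission
  imports "HOL-Algebra.Multiplicative_Group" Defs
begin

text \<open>
  A generator of \<open>G\<close> lifts to a matrix \<open>A\<close> that preserves \<open>F\<close> up to a constant.  If \<open>A\<close> were not
  diagonalizable, then it would act on some line as a translation, and comparing the restrictions
  of \<open>F\<close> and of its gradient to this line with their translates would yield a singular point.
  So let \<open>A\<close> be diagonal with entries \<open>\<alpha>\<^sub>1, \<alpha>\<^sub>2, \<alpha>\<^sub>3\<close>.  All monomials of \<open>F\<close> then have the same
  eigenvalue, and by non-singularity at the coordinate points \<open>F\<close> contains for every \<open>i\<close> a monomial
  \<open>x\<^sub>i\<^sup>d\<^sup>-\<^sup>1 x\<^sub>j\<close> with \<open>j = \<sigma> i\<close>.  Up to permutation there are seven maps \<open>\<sigma>\<close> on three letters, and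
  each makes the order of \<open>A\<close> modulo scalars divide one of the six integers; where \<open>\<sigma>\<close> swaps two
  letters and has no fixed point, this also needs a monomial avoiding one of the variables.
\<close>

section \<open>Evaluation at univariate polynomials\<close>

text \<open>Substituting the identity matrix fixes the monomial by \<open>lin_subst3_mat\<close>,
  while by definition it produces the product of the variables.\<close>

lemma single_eq_const3_times_vars:
  fixes c :: "'a::field"
  shows "Poly_Mapping.single m c = const3 c * (\<Prod>i\<in>UNIV. var3 i ^ Poly_Mapping.lookup m i)"
proof -
  have h: "homogeneous3 (\<Sum>i\<in>UNIV. Poly_Mapping.lookup m i) (Poly_Mapping.single m c)"
    by (auto simp: homogeneous3_def)
  have l: "(\<Sum>j\<in>UNIV. const3 ((mat 1 :: 'a^3^3) $ i $ j) * var3 j) = var3 i" for i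
  proof -
    have "(\<Sum>j\<in>UNIV. const3 ((mat 1 :: 'a^3^3) $ i $ j) * var3 j)
        = (\<Sum>j\<in>UNIV. if i = j then var3 j else 0)"
      by (rule sum.cong) (auto simp: mat_def const3_def)
    then show ?thesis by simp
  qed
  show ?thesis
    using lin_subst3_mat[OF h, of 1] by (simp add: lin_subst3_single l) (simp add: const3_def)
qed

text \<open>Monomials are products of constants and variables. The rule reduces identities between
  ring homomorphisms or derivations to a check on these generators.\<close>

lemma poly3_induct [case_names const var add mult]:
  fixes F :: "'a::field poly3"
  assumes const: "\<And>c. P (const3 c)" and var: "\<And>i. P (var3 i)"
    and add: "\<And>F G. P F \<Longrightarrow> P G \<Longrightarrow> P (F + G)" and mult: "\<And>F G. P F \<Longrightarrow> P G \<Longrightarrow> P (F * G)"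
  shows "P F"
proof -
  have 0: "P 0" and 1: "P 1"
    using const[of 0] const[of 1] by (simp_all add: const3_def)
  have pow: "P (G ^ n)" if "P G" for G n
    by (induction n) (auto simp: 1 that mult)
  have prod: "P (prod f S)" if "\<And>i. P (f i)" for f and S :: "3 set"
    by (induction S rule: infinite_finite_induct) (auto simp: 1 that mult)
  have sum: "P (sum f S)" if "\<And>i. P (f i)" for f and S :: "(3 \<Rightarrow>\<^sub>0 nat) set"
    by (induction S rule: infinite_finite_induct) (auto simp: 0 that add)
  have "P (\<Sum>m \<in> Poly_Mapping.keys F. Poly_Mapping.single m (Poly_Mapping.lookup F m))"
    by (intro sum) (simp only: single_eq_const3_times_vars, intro mult const prod pow var)
  then show ?thesis by (simp only: poly3_decomp[symmetric])
qed

lemma const3_mult: "const3 (a * b) = const3 a * const3 b"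
  by (simp add: const3_def mult_single)

lemma const3_power: "const3 (a ^ n) = const3 a ^ n"
  by (induction n) (simp_all add: const3_mult, simp add: const3_def)

lemma const3_prod: "const3 (prod f S) = (\<Prod>i\<in>S. const3 (f i))"
  by (induction S rule: infinite_finite_induct) (simp_all add: const3_mult, simp_all add: const3_def)

text \<open>Substitution of univariate polynomials for the coordinates, that is, \<open>F\<close>
  along the parametrized curve \<open>u\<close>. For linear \<open>u\<close> this is the restriction
  to a line.\<close>

definition evp :: "'a::comm_semiring_1 poly3 \<Rightarrow> (3 \<Rightarrow> 'a poly) \<Rightarrow> 'a poly" where
  "evp F u = (\<Sum>m \<in> Poly_Mapping.keys F.
     [:Poly_Mapping.lookup F m:] * (\<Prod>i\<in>UNIV. u i ^ Poly_Mapping.lookup m i))"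

lemma evp_add: "evp (F + G) u = evp F u + evp G u"
  unfolding evp_def
  by (rule setsum_keys_plus_distrib) (simp_all flip: add_pCons distrib_right add: algebra_simps smult_add_left)

lemma evp_zero [simp]: "evp 0 u = 0"
  by (simp add: evp_def)

lemma evp_single: "evp (Poly_Mapping.single m a) u = [:a:] * (\<Prod>i\<in>UNIV. u i ^ Poly_Mapping.lookup m i)"
  by (simp add: evp_def)

lemma evp_const [simp]: "evp (const3 c) u = [:c:]"
  by (simp add: evp_single const3_def)

lemma evp_var [simp]: "evp (var3 i) u = u i"
proof -
  have "(\<Prod>k\<in>UNIV. u k ^ Poly_Mapping.lookup (Poly_Mapping.single i (1::nat)) k)
      = (\<Prod>k\<in>UNIV. if k = i then u k else 1)"
    by (rule prod.cong) (auto simp: lookup_single when_def)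
  then show ?thesis by (simp add: var3_def evp_single)
qed

lemma evp_sum: "evp (sum f S) u = (\<Sum>x\<in>S. evp (f x) u)"
  by (induction S rule: infinite_finite_induct) (auto simp: evp_add)

lemma evp_mult: "evp (F * G) u = evp F u * evp G u"
proof -
  let ?F = "\<Sum>m \<in> Poly_Mapping.keys F. Poly_Mapping.single m (Poly_Mapping.lookup F m)"
  let ?G = "\<Sum>m \<in> Poly_Mapping.keys G. Poly_Mapping.single m (Poly_Mapping.lookup G m)"
  have s: "evp (Poly_Mapping.single m a * Poly_Mapping.single n b) u =
      evp (Poly_Mapping.single m a) u * evp (Poly_Mapping.single n b) u" for m n a b
    by (simp add: mult_single evp_single lookup_add power_add prod.distrib mult_ac)
  have "evp (?F * ?G) u = evp ?F u * evp ?G u"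
    by (simp only: sum_product evp_sum s)
  then show ?thesis by (simp only: poly3_decomp[symmetric])
qed

lemma evp_lin_subst3:
  fixes F :: "'a::field poly3"
  shows "evp (lin_subst3 A F) u = evp F (\<lambda>i. \<Sum>j\<in>UNIV. [:A $ i $ j:] * u j)"
  by (induction F rule: poly3_induct)
     (simp_all add: lin_subst3_add lin_subst3_mult lin_subst3_var evp_add evp_mult evp_sum)

lemma evp_pcompose:
  fixes F :: "'a::field poly3"
  shows "evp F (\<lambda>i. pcompose (u i) q) = pcompose (evp F u) q"
  by (induction F rule: poly3_induct) (simp_all add: evp_add evp_mult pcompose_add pcompose_mult)

lemma poly_evp: "poly (evp F u) t = eval3 F (\<chi> i. poly (u i) t)"
  by (simp add: evp_def eval3_def poly_sum poly_prod)

text \<open>Constant polynomials make point evaluation a special case of \<open>evp\<close>, so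
  \<open>eval3\<close> inherits its additive and multiplicative laws.\<close>

lemma eval3_eq_evp: "eval3 F v = poly (evp F (\<lambda>i. [:v $ i:])) 0"
  by (simp add: poly_evp)

lemma eval3_mult: "eval3 (F * G) v = eval3 F v * eval3 G v"
  by (simp add: eval3_eq_evp evp_mult)

lemma eval3_const [simp]: "eval3 (const3 c) v = c"
  by (simp add: eval3_eq_evp)

lemma eval3_sum: "eval3 (sum f S) v = (\<Sum>x\<in>S. eval3 (f x) v)"
  by (simp add: eval3_eq_evp evp_sum poly_sum)

lemma eval3_single:
  "eval3 (Poly_Mapping.single m a) v = a * (\<Prod>i\<in>UNIV. (v $ i) ^ Poly_Mapping.lookup m i)"
  by (simp add: eval3_def)

lemma eval3_lin_subst3:
  fixes F :: "'a::field poly3"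
  shows "eval3 (lin_subst3 A F) v = eval3 F (A *v v)"
  by (simp add: eval3_eq_evp evp_lin_subst3) (simp add: poly_evp matrix_vector_mult_def poly_sum mult.commute)

section \<open>Formal derivatives\<close>

lemma pderiv3_zero [simp]: "pderiv3 i 0 = 0"
  by (simp add: pderiv3_def)

lemma pderiv3_single:
  "pderiv3 i (Poly_Mapping.single m a) =
     Poly_Mapping.single (m - Poly_Mapping.single i 1) (of_nat (Poly_Mapping.lookup m i) * a)"
  by (simp add: pderiv3_def)

lemma pderiv3_add: "pderiv3 i (F + G) = pderiv3 i F + pderiv3 i G"
  unfolding pderiv3_def
  by (rule setsum_keys_plus_distrib) (simp_all add: distrib_left single_add)

lemma pderiv3_sum: "pderiv3 i (sum f S) = (\<Sum>x\<in>S. pderiv3 i (f x))"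
  by (induction S rule: infinite_finite_induct) (auto simp: pderiv3_add)

lemma pderiv3_const [simp]: "pderiv3 i (const3 c) = 0"
  by (simp add: const3_def pderiv3_single)

lemma pderiv3_var: "pderiv3 i (var3 j) = (if i = j then 1 else 0)"
  by (simp add: var3_def pderiv3_single lookup_single)

lemma pderiv3_mult_single:
  fixes a b :: "'a::comm_semiring_1"
  defines "M \<equiv> \<lambda>m. Poly_Mapping.single m a" and "N \<equiv> \<lambda>n. Poly_Mapping.single n b"
  shows "pderiv3 i (M m * N n) = pderiv3 i (M m) * N n + M m * pderiv3 i (N n)"
proof -
  define e :: "3 \<Rightarrow>\<^sub>0 nat" where "e = Poly_Mapping.single i 1"
  \<comment> \<open>Truncated subtraction can make the exponents differ only where \<open>i\<close>
    does not occur in \<open>m\<close>, and there both coefficients are zero.\<close>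
  have 1: "Poly_Mapping.single (m + n - e) (of_nat (Poly_Mapping.lookup m i) * (a * b)) =
      Poly_Mapping.single (m - e + n) (of_nat (Poly_Mapping.lookup m i) * (a * b))"
  proof (cases "Poly_Mapping.lookup m i = 0")
    case False
    have "m + n - e = m - e + n"
      by (rule poly_mapping_eqI) (use False in \<open>auto simp: lookup_add lookup_minus e_def lookup_single when_def\<close>)
    then show ?thesis by simp
  qed simp
  have 2: "Poly_Mapping.single (m + n - e) (of_nat (Poly_Mapping.lookup n i) * (a * b)) =
      Poly_Mapping.single (m + (n - e)) (of_nat (Poly_Mapping.lookup n i) * (a * b))"
  proof (cases "Poly_Mapping.lookup n i = 0")
    case False
    have "m + n - e = m + (n - e)"
      by (rule poly_mapping_eqI) (use False in \<open>auto simp: lookup_add lookup_minus e_def lookup_single when_def\<close>)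
    then show ?thesis by simp
  qed simp
  show ?thesis
    unfolding M_def N_def mult_single pderiv3_single e_def[symmetric] lookup_add of_nat_add distrib_right
      single_add 1 2
    by (simp add: mult_ac)
qed

lemma pderiv3_mult:
  fixes F G :: "'a::comm_semiring_1 poly3"
  shows "pderiv3 i (F * G) = pderiv3 i F * G + F * pderiv3 i G"
proof -
  let ?f = "\<lambda>m. Poly_Mapping.single m (Poly_Mapping.lookup F m)"
  let ?g = "\<lambda>m. Poly_Mapping.single m (Poly_Mapping.lookup G m)"
  let ?F = "\<Sum>m \<in> Poly_Mapping.keys F. ?f m" and ?G = "\<Sum>m \<in> Poly_Mapping.keys G. ?g m"
  have "pderiv3 i (?F * ?G) = pderiv3 i ?F * ?G + ?F * pderiv3 i ?G"
    by (simp only: sum_product pderiv3_sum pderiv3_mult_single sum.distrib)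
  then show ?thesis
    by (simp only: poly3_decomp[symmetric])
qed

text \<open>Chain rule, with \<open>A\<close> acting on gradients by its transpose. Both sides obey
  the sum and product rules, so only variables need a computation.\<close>

lemma pderiv3_lin_subst3:
  fixes F :: "'a::field poly3"
  shows "pderiv3 i (lin_subst3 A F) = (\<Sum>j\<in>UNIV. const3 (A $ j $ i) * lin_subst3 A (pderiv3 j F))"
proof (induction F arbitrary: i rule: poly3_induct)
  case (var k)
  have "pderiv3 i (lin_subst3 A (var3 k)) = (\<Sum>j\<in>UNIV. if i = j then const3 (A $ k $ j) else 0)"
    unfolding lin_subst3_var pderiv3_sum
    by (rule sum.cong) (auto simp: pderiv3_mult pderiv3_var)
  moreover have "(\<Sum>j\<in>UNIV. const3 (A $ j $ i) * lin_subst3 A (pderiv3 j (var3 k))) =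
      (\<Sum>j\<in>UNIV. if j = k then const3 (A $ j $ i) else 0)"
    by (rule sum.cong) (auto simp: pderiv3_var)
  ultimately show ?case by simp
qed (simp_all add: lin_subst3_add lin_subst3_mult pderiv3_add pderiv3_mult algebra_simps
       sum.distrib sum_distrib_left)

text \<open>Chain rule along the curve \<open>u\<close>, checked on generators since both sides are
  additive and satisfy the Leibniz rule.\<close>

lemma pderiv_evp:
  fixes F :: "'a::field poly3"
  shows "pderiv (evp F u) = (\<Sum>i\<in>UNIV. pderiv (u i) * evp (pderiv3 i F) u)"
proof (induction F rule: poly3_induct)
  case (var k)
  have "(\<Sum>i\<in>UNIV. pderiv (u i) * evp (pderiv3 i (var3 k)) u) =
      (\<Sum>i\<in>UNIV. if i = k then pderiv (u i) else 0)"
    by (rule sum.cong) (use evp_const[of 1 u] in \<open>auto simp: pderiv3_var const3_def\<close>)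
  then show ?case by simp
qed (simp_all add: evp_add evp_mult pderiv3_add pderiv3_mult pderiv_add pderiv_mult algebra_simps
       sum.distrib sum_distrib_left pderiv_pCons)

section \<open>Homogeneous polynomials\<close>

lemma homogeneous3_add: "homogeneous3 d F \<Longrightarrow> homogeneous3 d G \<Longrightarrow> homogeneous3 d (F + G)"
  using Poly_Mapping.keys_add[of F G] unfolding homogeneous3_def by blast

lemma homogeneous3_mult:
  "homogeneous3 d F \<Longrightarrow> homogeneous3 e G \<Longrightarrow> homogeneous3 (d + e) (F * G)"
  using keys_mult[of F G] unfolding homogeneous3_def
  by (fastforce simp: lookup_add sum.distrib)

lemma homogeneous3_sum: "(\<And>x. x \<in> S \<Longrightarrow> homogeneous3 d (f x)) \<Longrightarrow> homogeneous3 d (sum f S)"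
  by (induction S rule: infinite_finite_induct)
     (auto intro!: homogeneous3_add simp: homogeneous3_def[of _ 0])

lemma homogeneous3_const: "homogeneous3 0 (const3 c)"
  by (simp add: homogeneous3_def const3_def)

lemma homogeneous3_var: "homogeneous3 1 (var3 i)"
  by (simp add: homogeneous3_def var3_def lookup_single when_def)

lemma homogeneous3_one: "homogeneous3 0 (1 :: 'a::semiring_1 poly3)"
  using homogeneous3_const[of "1 :: 'a"] by (simp add: const3_def)

lemma homogeneous3_power: "homogeneous3 d F \<Longrightarrow> homogeneous3 (n * d) (F ^ n)"
  by (induction n) (auto intro: homogeneous3_mult homogeneous3_one)

lemma homogeneous3_prod:
  "(\<And>x. x \<in> S \<Longrightarrow> homogeneous3 (e x) (f x)) \<Longrightarrow> homogeneous3 (sum e S) (prod f S)"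
  by (induction S rule: infinite_finite_induct) (auto intro: homogeneous3_mult homogeneous3_one)

lemma homogeneous3_lin_subst3:
  assumes "homogeneous3 d F"
  shows "homogeneous3 d (lin_subst3 A F)"
  unfolding lin_subst3_def
proof (rule homogeneous3_sum)
  fix m assume m: "m \<in> Poly_Mapping.keys F"
  have l: "homogeneous3 1 (\<Sum>j\<in>UNIV. const3 (A $ i $ j) * var3 j)" for i
    by (rule homogeneous3_sum) (use homogeneous3_mult[OF homogeneous3_const homogeneous3_var] in simp)
  have "homogeneous3 (0 + (\<Sum>i\<in>UNIV. Poly_Mapping.lookup m i * 1))
     (const3 (Poly_Mapping.lookup F m) *
       (\<Prod>i\<in>UNIV. (\<Sum>j\<in>UNIV. const3 (A $ i $ j) * var3 j) ^ Poly_Mapping.lookup m i))"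
    by (intro homogeneous3_mult homogeneous3_const homogeneous3_prod homogeneous3_power l)
  then show "homogeneous3 d (const3 (Poly_Mapping.lookup F m) *
       (\<Prod>i\<in>UNIV. (\<Sum>j\<in>UNIV. const3 (A $ i $ j) * var3 j) ^ Poly_Mapping.lookup m i))"
    using m assms by (simp add: homogeneous3_def)
qed

lemma homogeneous3_pderiv3:
  assumes "homogeneous3 d F"
  shows "homogeneous3 (d - 1) (pderiv3 i F)"
  unfolding pderiv3_def
proof (rule homogeneous3_sum)
  fix m assume m: "m \<in> Poly_Mapping.keys F"
  have "(\<Sum>k\<in>UNIV. Poly_Mapping.lookup (m - Poly_Mapping.single i 1) k) = d - 1"
    if "Poly_Mapping.lookup m i \<noteq> 0"
  proof -
    have "(\<Sum>k\<in>UNIV. Poly_Mapping.lookup (m - Poly_Mapping.single i 1) k) + 1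
        = (\<Sum>k\<in>UNIV. Poly_Mapping.lookup (m - Poly_Mapping.single i 1) k + (if k = i then 1 else 0))"
      by (simp add: sum.distrib)
    also have "\<dots> = (\<Sum>k\<in>UNIV. Poly_Mapping.lookup m k)"
      by (rule sum.cong) (use that in \<open>auto simp: lookup_minus lookup_single when_def\<close>)
    finally show ?thesis using m assms by (simp add: homogeneous3_def)
  qed
  then show "homogeneous3 (d - 1) (Poly_Mapping.single (m - Poly_Mapping.single i 1)
       (of_nat (Poly_Mapping.lookup m i) * Poly_Mapping.lookup F m))"
    by (cases "Poly_Mapping.lookup m i = 0") (auto simp: homogeneous3_def)
qed

text \<open>Multiplying the \<open>i\<close>-th derivative of a monomial by \<open>var3 i\<close>
  restores the monomial times its exponent in that variable, and the exponents add up to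
  \<open>d\<close>.\<close>

lemma euler_identity:
  assumes "homogeneous3 d F"
  shows "(\<Sum>i\<in>UNIV. var3 i * pderiv3 i F) = const3 (of_nat d) * F"
proof -
  have v: "var3 i * Poly_Mapping.single (m - Poly_Mapping.single i 1)
       (of_nat (Poly_Mapping.lookup m i) * a) = Poly_Mapping.single m (of_nat (Poly_Mapping.lookup m i) * a)"
    for i and a :: 'a and m :: "3 \<Rightarrow>\<^sub>0 nat"
  proof (cases "Poly_Mapping.lookup m i = 0")
    case False
    have "Poly_Mapping.single i 1 + (m - Poly_Mapping.single i 1) = m"
      by (rule poly_mapping_eqI) (use False in \<open>auto simp: lookup_add lookup_minus lookup_single when_def\<close>)
    then show ?thesis by (simp add: var3_def mult_single)
  qed simp
  have s: "(\<Sum>i\<in>S. Poly_Mapping.single m (f i)) = Poly_Mapping.single m (sum f S)"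
    for S and f :: "3 \<Rightarrow> 'a" and m :: "3 \<Rightarrow>\<^sub>0 nat"
    by (induction S rule: infinite_finite_induct) (auto simp: single_add)
  have "(\<Sum>i\<in>UNIV. var3 i * pderiv3 i F) = (\<Sum>m\<in>Poly_Mapping.keys F. \<Sum>i\<in>UNIV.
      Poly_Mapping.single m (of_nat (Poly_Mapping.lookup m i) * Poly_Mapping.lookup F m))"
    unfolding pderiv3_def sum_distrib_left v by (rule sum.swap)
  also have "\<dots> = (\<Sum>m\<in>Poly_Mapping.keys F. const3 (of_nat d) * Poly_Mapping.single m (Poly_Mapping.lookup F m))"
    using assms unfolding s const3_def mult_single
    by (intro sum.cong) (auto simp: homogeneous3_def simp flip: sum_distrib_right of_nat_sum)
  also have "\<dots> = const3 (of_nat d) * F"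
    by (subst (3) poly3_decomp[of F]) (simp only: sum_distrib_left)
  finally show ?thesis .
qed

text \<open>In the convolution every other term has an index beyond one of the bounds. Bounds
  replace exact degrees because the coefficients at \<open>m\<close> and \<open>n\<close> may be
  zero.\<close>

lemma coeff_mult_at_degree_bound:
  assumes "degree p \<le> m" "degree q \<le> n"
  shows "coeff (p * q) (m + n) = coeff p m * coeff q n"
proof -
  have "coeff (p * q) (m + n) = (\<Sum>i\<le>m + n. coeff p i * coeff q (m + n - i))"
    by (rule coeff_mult)
  also have "\<dots> = (\<Sum>i\<in>{m}. coeff p i * coeff q (m + n - i))"
  proof (rule sum.mono_neutral_right)
    show "\<forall>i\<in>{..m + n} - {m}. coeff p i * coeff q (m + n - i) = 0"
    proof
      fix i assume "i \<in> {..m + n} - {m}"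
      then consider "i > m" | "m + n - i > n" by force
      then show "coeff p i * coeff q (m + n - i) = 0"
        by cases (use assms in \<open>simp_all add: coeff_eq_0\<close>)
    qed
  qed auto
  finally show ?thesis by simp
qed

lemma degree_coeff_power_linear:
  fixes a b :: "'a::comm_semiring_1"
  shows "degree ([:a, b:] ^ n) \<le> n \<and> coeff ([:a, b:] ^ n) n = b ^ n"
proof (induction n)
  case (Suc n)
  have "coeff ([:a, b:] * [:a, b:] ^ n) (1 + n) = b * b ^ n"
    by (subst coeff_mult_at_degree_bound) (use Suc in auto)
  moreover have "degree ([:a, b:] * [:a, b:] ^ n) \<le> 1 + n"
    using Suc degree_mult_le[of "[:a, b:]" "[:a, b:] ^ n"] degree_pCons_le[of a "[:b:]"] by simp
  ultimately show ?case by simp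
qed simp

text \<open>Each monomial becomes a constant times \<open>d\<close> linear factors in
  \<open>t\<close>, and its coefficient of \<open>t^d\<close> collects their slopes. The result is
  the value at \<open>e\<close>, the point at infinity of the line \<open>f + t e\<close>.\<close>

lemma evp_line_top_coeff:
  fixes F :: "'a::comm_ring_1 poly3"
  assumes "homogeneous3 d F"
  shows "coeff (evp F (\<lambda>i. [:f $ i, e $ i:])) d = eval3 F e"
proof -
  have p: "degree (\<Prod>i\<in>S. [:f $ i, e $ i:] ^ m i) \<le> sum m S \<and>
      coeff (\<Prod>i\<in>S. [:f $ i, e $ i:] ^ m i) (sum m S) = (\<Prod>i\<in>S. (e $ i) ^ m i)" for m S
  proof (induction S rule: infinite_finite_induct)
    case (insert x S)
    have "degree ([:f $ x, e $ x:] ^ m x * (\<Prod>i\<in>S. [:f $ i, e $ i:] ^ m i)) \<le> m x + sum m S"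
      using degree_mult_le[of "[:f $ x, e $ x:] ^ m x" "\<Prod>i\<in>S. [:f $ i, e $ i:] ^ m i"]
        degree_coeff_power_linear[of "f $ x" "e $ x" "m x"] insert by linarith
    then show ?case
      using insert degree_coeff_power_linear[of "f $ x" "e $ x" "m x"]
      by (simp add: coeff_mult_at_degree_bound)
  qed auto
  show ?thesis
    unfolding evp_def eval3_def coeff_sum
  proof (rule sum.cong)
    fix m assume "m \<in> Poly_Mapping.keys F"
    then have "sum (Poly_Mapping.lookup m) UNIV = d" using assms by (simp add: homogeneous3_def)
    then show "coeff ([:Poly_Mapping.lookup F m:] * (\<Prod>i\<in>UNIV. [:f $ i, e $ i:] ^ Poly_Mapping.lookup m i)) d
       = Poly_Mapping.lookup F m * (\<Prod>i\<in>UNIV. (e $ i) ^ Poly_Mapping.lookup m i)"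
      using p[of "Poly_Mapping.lookup m" UNIV] by simp
  qed simp
qed

lemma nonsingular_lin_subst3:
  fixes F :: "'a::field poly3"
  assumes F: "nonsingular_plane_curve d F" and P: "P ** Q = mat 1"
  shows "nonsingular_plane_curve d (lin_subst3 P F)"
  unfolding nonsingular_plane_curve_def
proof (intro conjI allI impI)
  have QP: "Q ** P = mat 1" using P by (simp add: matrix_left_right_inverse)
  show "homogeneous3 d (lin_subst3 P F)"
    using F by (simp add: nonsingular_plane_curve_def homogeneous3_lin_subst3)
  have "lin_subst3 Q (lin_subst3 P F) = F"
    using F lin_subst3_mat[of d F 1]
    by (simp add: lin_subst3_lin_subst3 P nonsingular_plane_curve_def const3_def)
  then show "lin_subst3 P F \<noteq> 0" using F by (auto simp: nonsingular_plane_curve_def)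
  fix v :: "'a^3" assume v: "v \<noteq> 0"
  show "\<not> singular_at (lin_subst3 P F) v"
  proof
    assume s: "singular_at (lin_subst3 P F) v"
    \<comment> \<open>Gradient of \<open>F\<close> at the image point. By the chain rule
      \<open>w v* P\<close> is the gradient of the transformed polynomial at \<open>v\<close>, and
      \<open>P\<close> is invertible.\<close>
    define w :: "'a^3" where "w = (\<chi> j. eval3 (pderiv3 j F) (P *v v))"
    have "(w v* P) $ i = 0" for i
      using s by (simp add: singular_at_def pderiv3_lin_subst3 eval3_sum eval3_mult eval3_lin_subst3
          vector_matrix_mult_def w_def mult.commute)
    then have "w v* P = 0" by (simp add: vec_eq_iff)
    then have "(w v* P) v* Q = 0" by (simp add: vector_matrix_mult_def vec_eq_iff)
    then have "w = 0" by (simp add: vector_matrix_mul_assoc P)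
    then have "singular_at F (P *v v)"
      using s by (auto simp: singular_at_def eval3_lin_subst3 w_def vec_eq_iff)
    moreover have "P *v v \<noteq> 0"
      using v QP by (metis matrix_vector_mul_assoc matrix_vector_mul_lid matrix_vector_mult_0_right)
    ultimately show False using F by (auto simp: nonsingular_plane_curve_def)
  qed
qed

section \<open>Diagonalization of matrices of size three\<close>

definition diag3 :: "(3 \<Rightarrow> 'a::zero) \<Rightarrow> 'a^3^3" where
  "diag3 \<alpha> = (\<chi> i j. if i = j then \<alpha> i else 0)"

lemma cayley_hamilton_3:
  fixes A :: "'a::field^3^3"
  obtains p q r where "\<And>u. A *v (A *v (A *v u)) = p *s (A *v (A *v u)) + q *s (A *v u) + r *s u"
proof
  fix u
  let ?a = "\<lambda>i j. A $ i $ j"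
  \<comment> \<open>Trace, negated sum of the principal minors of size two, and determinant.\<close>
  let ?p = "?a 1 1 + ?a 2 2 + ?a 3 3"
  let ?q = "?a 1 2 * ?a 2 1 + ?a 1 3 * ?a 3 1 + ?a 2 3 * ?a 3 2 - ?a 1 1 * ?a 2 2 - ?a 1 1 * ?a 3 3 - ?a 2 2 * ?a 3 3"
  let ?r = "?a 1 1 * ?a 2 2 * ?a 3 3 + ?a 1 2 * ?a 2 3 * ?a 3 1 + ?a 1 3 * ?a 2 1 * ?a 3 2
     - ?a 1 1 * ?a 2 3 * ?a 3 2 - ?a 1 2 * ?a 2 1 * ?a 3 3 - ?a 1 3 * ?a 2 2 * ?a 3 1"
  show "A *v (A *v (A *v u)) = ?p *s (A *v (A *v u)) + ?q *s (A *v u) + ?r *s u"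
    by (simp add: vec_eq_iff forall_3 matrix_vector_mult_def sum_3) (simp add: algebra_simps)
qed

text \<open>The numbers are the roots of \<open>x^3 - p x^2 - q x - r\<close>: a root
  \<open>a\<close> of the cubic, a root \<open>b\<close> of its quotient by \<open>x - a\<close>,
  and \<open>c = p - a - b\<close>.\<close>

lemma cubic_splits:
  fixes p q r :: "'a::alg_closed_field"
  obtains a b c where "p = a + b + c" "q = - (a * b + a * c + b * c)" "r = a * b * c"
proof -
  have deg: "degree [:- r, - q, - p, 1:] = 3" by simp
  obtain a where a: "poly [:- r, - q, - p, 1:] a = 0"
    using alg_closed_imp_poly_has_root[of "[:- r, - q, - p, 1:]"] by auto
  have r: "r = a * (a * (a - p) - q)" using a by (simp add: algebra_simps)
  obtain b where b: "poly [:a * (a - p) - q, a - p, 1:] b = 0"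
    using alg_closed_imp_poly_has_root[of "[:a * (a - p) - q, a - p, 1:]"] by auto
  have q: "a * (a - p) - q = - b * (b + a - p)" using b by (simp add: algebra_simps eq_neg_iff_add_eq_0)
  show ?thesis
  proof
    show "p = a + b + (p - a - b)" by simp
    show "q = - (a * b + a * (p - a - b) + b * (p - a - b))"
      using q by (simp add: algebra_simps)
    show "r = a * b * (p - a - b)" unfolding r q by (simp add: algebra_simps)
  qed
qed

text \<open>By Cayley-Hamilton a product of three factors \<open>A - a\<close>,
  \<open>A - b\<close>, \<open>A - c\<close> vanishes, so one of them moves some vector outside the
  span \<open>W\<close> of the eigenvectors into \<open>W\<close>. Correcting this vector by an
  element of \<open>W\<close> makes its image an eigenvector.\<close>

lemma eigenbasis_or_jordan_chain:
  fixes A :: "'a::alg_closed_field^3^3"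
  assumes not_span: "vec.span {v. \<exists>l. A *v v = l *s v} \<noteq> UNIV"
  obtains l e f where "e \<noteq> 0" "A *v e = l *s e" "A *v f = l *s f + e"
proof -
  define W where "W = vec.span {v. \<exists>l. A *v v = l *s v}"
  note lin = matrix_vector_right_distrib matrix_vector_mult_diff_distrib vec.scale vec.scale_right_distrib
    vec.scale_right_diff_distrib vec.scale_left_distrib vec.scale_left_diff_distrib
  obtain u where u: "u \<notin> W" using not_span by (auto simp: W_def)
  obtain p q r where ch: "\<And>u. A *v (A *v (A *v u)) = p *s (A *v (A *v u)) + q *s (A *v u) + r *s u"
    by (rule cayley_hamilton_3[of A]) blast
  obtain a b c where abc: "p = a + b + c" "q = - (a * b + a * c + b * c)" "r = a * b * c"
    by (rule cubic_splits)
  define u1 where "u1 = A *v u - a *s u"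
  define u2 where "u2 = A *v u1 - b *s u1"
  have "A *v u2 - c *s u2 = 0"
    unfolding u2_def u1_def by (simp add: lin ch abc) (simp add: vec_eq_iff algebra_simps)
  moreover have "0 \<in> W" unfolding W_def by (rule vec.span_zero)
  \<comment> \<open>In the chain \<open>u\<close>, \<open>u1\<close>, \<open>u2\<close>,
    \<open>0\<close> the last vector outside \<open>W\<close> serves as \<open>v\<close>.\<close>
  ultimately have "\<exists>v l. v \<notin> W \<and> A *v v - l *s v \<in> W"
    using u unfolding u2_def u1_def by metis
  then obtain v l where v: "v \<notin> W" "A *v v - l *s v \<in> W" by blast
  \<comment> \<open>Moving \<open>v\<close> by an element of \<open>W\<close> removes from \<open>A v - l v\<close> all components with eigenvalue
    different from \<open>l\<close>.\<close>
  have correct: "\<exists>b\<in>W. \<exists>e. A *v e = l *s e \<and> A *v b - l *s b + w = e" if "w \<in> W" for w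
    using that unfolding W_def
  proof (induction rule: vec.span_induct_alt)
    case base
    then show ?case by (intro bexI[of _ 0] exI[of _ 0]) (auto simp: vec.span_zero)
  next
    case (step k x y)
    then obtain b e m where b: "b \<in> W" "A *v e = l *s e" "A *v b - l *s b + y = e" "A *v x = m *s x"
      by (auto simp: W_def)
    show ?case
    proof (cases "m = l")
      case True
      have "A *v (k *s x + e) = l *s (k *s x + e)"
        using b(2,4) True by (simp add: lin mult.commute)
      moreover have "A *v b - l *s b + (k *s x + y) = k *s x + e"
        unfolding b(3)[symmetric] by simp
      ultimately show ?thesis using b(1) unfolding W_def by blast
    next
      case False
      \<comment> \<open>\<open>A - l\<close> multiplies \<open>x\<close> by \<open>m - l\<close>, so
        this shift cancels the summand \<open>k *s x\<close>.\<close>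
      let ?b = "b - (k / (m - l)) *s x"
      have "?b \<in> W"
        unfolding W_def using b(1) step.hyps(1)
        by (auto simp: W_def intro!: vec.span_diff vec.span_scale intro: vec.span_base)
      moreover have "A *v ?b - l *s ?b + (k *s x + y) = e"
        using False by (simp add: lin b(3)[symmetric] b(4)) (simp add: vec_eq_iff field_simps)
      ultimately show ?thesis using b(2) by (auto simp: W_def)
    qed
  qed
  obtain b where b: "b \<in> W" and e: "A *v (A *v b - l *s b + (A *v v - l *s v)) = l *s (A *v b - l *s b + (A *v v - l *s v))"
    using correct[OF v(2)] by blast
  define e where "e = A *v b - l *s b + (A *v v - l *s v)"
  have f: "A *v (b + v) = l *s (b + v) + e" unfolding e_def by (simp add: lin)
  \<comment> \<open>Being outside \<open>W\<close>, \<open>b + v\<close> is no eigenvector, which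
    makes \<open>e\<close> nonzero.\<close>
  have "b + v \<notin> W"
    using v(1) b vec.span_diff[of "b + v" _ b] by (auto simp: W_def)
  then have "A *v (b + v) \<noteq> l *s (b + v)"
    unfolding W_def by (auto intro: vec.span_base)
  then have "e \<noteq> 0" using f by auto
  then show ?thesis using that[of e l "b + v"] f e by (simp add: e_def)
qed

text \<open>A maximal independent set of eigenvectors is a basis; its vectors form the columns of
  \<open>P\<close> and their eigenvalues the diagonal.\<close>

lemma eigenbasis_diagonalizes:
  fixes A :: "'a::field^3^3"
  assumes span: "vec.span {v. \<exists>l. A *v v = l *s v} = UNIV"
  obtains P Q :: "'a^3^3" and \<alpha> :: "3 \<Rightarrow> 'a"
  where "P ** Q = mat 1" "Q ** P = mat 1" "A ** P = P ** diag3 \<alpha>"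
proof -
  obtain B where B: "B \<subseteq> {v. \<exists>l. A *v v = l *s v}" "vec.independent B"
      "{v. \<exists>l. A *v v = l *s v} \<subseteq> vec.span B"
    by (rule vec.maximal_independent_subset)
  have "vec.span B = UNIV"
    using vec.span_minimal[OF B(3) vec.subspace_span] span by auto
  then have "card B = CARD(3)"
    using vec.dim_span_eq_card_independent[OF B(2)] vec_dim_card by metis
  moreover have "finite B" using B(2) by (rule vec.finiteI_independent)
  ultimately obtain b :: "3 \<Rightarrow> 'a^3" where b: "bij_betw b UNIV B"
    by (metis finite_same_card_bij finite_class.finite_UNIV)
  define P :: "'a^3^3" where "P = (\<chi> i j. b j $ i)"
  have "columns P = B"
    using b by (auto simp: columns_def column_def P_def bij_betw_def image_def)
  then obtain Q where Q: "P ** Q = mat 1"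
    using matrix_right_invertible_span_columns[of P] \<open>vec.span B = UNIV\<close> by auto
  have "\<forall>i. \<exists>l. A *v b i = l *s b i" using B(1) b by (auto simp: bij_betw_def)
  then obtain \<alpha> where \<alpha>: "\<And>i. A *v b i = \<alpha> i *s b i" by metis
  have "(A ** P) $ i $ j = (P ** diag3 \<alpha>) $ i $ j" for i j
  proof -
    have "(A ** P) $ i $ j = (A *v b j) $ i"
      by (simp add: matrix_matrix_mult_def matrix_vector_mult_def P_def)
    also have "\<dots> = (P ** diag3 \<alpha>) $ i $ j"
      by (simp add: \<alpha> diag3_def matrix_matrix_mult_def P_def if_distrib mult.commute cong: if_cong)
    finally show ?thesis .
  qed
  then have "A ** P = P ** diag3 \<alpha>" by (simp add: vec_eq_iff)
  moreover have "Q ** P = mat 1" using Q by (simp add: matrix_left_right_inverse)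
  ultimately show ?thesis using that Q by blast
qed

text \<open>If \<open>f\<close> were a multiple of \<open>e\<close>, it would satisfy
  \<open>A *v f = l *s f\<close>, forcing \<open>e = 0\<close>. So \<open>e\<close> and
  \<open>f\<close> span a plane, and any vector outside it serves as \<open>g\<close>.\<close>

lemma chain_extends_to_spanning:
  fixes A :: "'a::field^3^3"
  assumes "e \<noteq> 0" "A *v e = l *s e" "A *v f = l *s f + e"
  obtains g where "vec.span {e, f, g} = UNIV"
proof -
  have "f \<notin> vec.span {e}"
  proof
    assume "f \<in> vec.span {e}"
    then obtain k where "f = k *s e" by (auto simp: vec.span_singleton)
    then have "e = 0" using assms(2,3) by (simp add: vec.scale mult.commute)
    then show False using assms(1) by simp
  qed
  then have ef: "vec.independent {f, e}"
    using assms(1) by (simp add: vec.independent_insert)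
  have "card {f, e} \<noteq> 3" using card_insert_le_m1[of 2 "{e}" f] by auto
  moreover have "vec.dim (vec.span {f, e}) = card {f, e}" 
    by (rule vec.dim_span_eq_card_independent[OF ef])
  moreover have dim: "vec.dim (UNIV :: ('a^3) set) = 3"
    using vec_dim_card[where ?'a = 'a and ?'n = 3] by simp
  ultimately have "vec.span {f, e} \<noteq> UNIV" by metis
  then obtain g where "g \<notin> vec.span {f, e}" by auto
  then have i: "vec.independent {g, f, e}" using ef by (rule vec.independent_insertI)
  have "g \<noteq> f" "g \<noteq> e" "f \<noteq> e"
    using \<open>g \<notin> vec.span {f, e}\<close> \<open>f \<notin> vec.span {e}\<close> vec.span_base by blast+
  then have "card {g, f, e} = 3" by simp
  then have "card {g, f, e} = vec.dim (UNIV :: ('a^3) set)" unfolding dim .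
  then have "vec.span {g, f, e} = UNIV"
    using vec.card_eq_dim[of "{g, f, e}" UNIV] i by auto
  then show ?thesis using that by (simp add: insert_commute)
qed

section \<open>Automorphisms are diagonalizable\<close>

lemma coeff_pcompose_shift:
  fixes p :: "'a::comm_ring_1 poly"
  shows "coeff (pcompose p [:1, 1:]) n = (\<Sum>i\<le>degree p. coeff p i * of_nat (i choose n))"
proof -
  have "pcompose p [:1, 1:] = (\<Sum>i\<le>degree p. smult (coeff p i) ([:1, 1:] ^ i))"
    by (simp add: pcompose_altdef poly_altdef degree_map_poly coeff_map_poly)
  moreover have "coeff ([:1, 1:] ^ i) n = (of_nat (i choose n) :: 'a)" for i
  proof (cases "n \<le> i")
    case True
    then show ?thesis by (simp add: coeff_linear_poly_power)
  next
    case False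
    then have "degree ([:1, 1 :: 'a:] ^ i) < n"
      using degree_coeff_power_linear[of "1 :: 'a" 1 i] by simp
    then show ?thesis using False by (simp add: coeff_eq_0 binomial_eq_0)
  qed
  ultimately show ?thesis by (simp add: coeff_sum)
qed

text \<open>Compare the two top coefficients. The leading one gives \<open>\<gamma> = c\<close>; the
  next then makes \<open>c\<close> times the degree times the leading coefficient zero, impossible
  in characteristic zero. If the degree exceeds the bound, \<open>k\<close> disturbs neither
  coefficient.\<close>

lemma degree_le_1_if_shift_eigen:
  fixes p :: "'a::field_char_0 poly"
  assumes eq: "smult \<gamma> (pcompose p [:1, 1:]) + [:k:] = smult c p" and c: "c \<noteq> 0"
  shows "degree p \<le> (if k = 0 then 0 else 1)"
proof (rule ccontr)
  assume *: "\<not> ?thesis"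
  define n where "n = degree p - 1"
  have n: "degree p = Suc n" "k = 0 \<or> n > 0" using * by (auto simp: n_def split: if_splits)
  have lead: "coeff p (Suc n) \<noteq> 0" using n(1) by (metis degree_0 leading_coeff_0_iff nat.distinct(1))
  have "coeff (pcompose p [:1, 1:]) (Suc n) = coeff p (Suc n)"
    by (simp add: coeff_pcompose_shift n(1) binomial_eq_0)
  moreover have "(\<Sum>i\<le>n. coeff p i * of_nat (i choose n)) = coeff p n"
    by (cases n) (simp_all add: binomial_eq_0)
  then have "coeff (pcompose p [:1, 1:]) n = coeff p n + of_nat (Suc n) * coeff p (Suc n)"
    by (simp add: coeff_pcompose_shift n(1))
  moreover have "coeff (smult \<gamma> (pcompose p [:1, 1:]) + [:k:]) i = coeff (smult c p) i" for i
    using eq by simp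
  from this[of "Suc n"] this[of n]
  have "\<gamma> * coeff (pcompose p [:1, 1:]) (Suc n) = c * coeff p (Suc n)"
    "\<gamma> * coeff (pcompose p [:1, 1:]) n = c * coeff p n"
    using n(2) by (auto simp: coeff_pCons split: nat.splits)
  ultimately have "\<gamma> = c" "c * (of_nat (Suc n) * coeff p (Suc n)) = 0"
    using lead by (simp_all add: distrib_left)
  then show False using c lead by (simp del: of_nat_Suc)
qed

lemma smult_sum_right: "smult c (sum f S) = (\<Sum>i\<in>S. smult c (f i))"
  by (induction S rule: infinite_finite_induct) (auto simp: smult_add_right)

text \<open>
  Let \<open>\<phi>(t) = F(f + t e)\<close>, and let \<open>\<Psi> w\<close> be the derivative of \<open>F\<close> in the direction \<open>w\<close> at
  \<open>f + t e\<close>; its coefficient of \<open>t\<^sup>d\<^sup>-\<^sup>1\<close> is the derivative at \<open>e\<close>.  As \<open>A\<close> shifts the line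
  \<open>f + t e\<close> by one, \<open>\<phi>\<close> is an eigenvector of the shift, hence constant, and \<open>\<Psi> g\<close> is one up to a
  constant, hence of degree at most \<open>1 < d - 1\<close>.  So \<open>e\<close> is a singular point.
\<close>

lemma nonsingular_no_unipotent_chain:
  fixes F :: "'a::field_char_0 poly3"
  assumes d: "d \<ge> 3" and F: "nonsingular_plane_curve d F" and "preserves A F"
    and e: "e \<noteq> 0" "A *v e = e" and f: "A *v f = f + e" and g: "vec.span {e, f, g} = UNIV"
  shows False
proof -
  obtain c where c: "c \<noteq> 0" "lin_subst3 A F = const3 c * F"
    using \<open>preserves A F\<close> by (auto simp: preserves_def)
  have hom: "homogeneous3 d F" using F by (simp add: nonsingular_plane_curve_def)
  define u where "u = (\<lambda>i. [:f $ i, e $ i:])"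
  define \<phi> where "\<phi> = evp F u"
  define \<Psi> where "\<Psi> w = (\<Sum>i\<in>UNIV. smult (w $ i) (evp (pderiv3 i F) u))" for w :: "'a^3"
  have \<Psi>_lin: "\<Psi> (v + w) = \<Psi> v + \<Psi> w" "\<Psi> (a *s w) = smult a (\<Psi> w)" for v w a
    by (simp_all add: \<Psi>_def smult_add_left sum.distrib smult_sum_right)
  have Au: "(\<lambda>i. \<Sum>j\<in>UNIV. [:A $ i $ j:] * u j) = (\<lambda>i. pcompose (u i) [:1, 1:])"
  proof
    fix i
    have "(\<Sum>j\<in>UNIV. [:A $ i $ j:] * u j) = [:(A *v f) $ i, (A *v e) $ i:]"
      by (simp add: u_def matrix_vector_mult_def sum_3)
    then show "(\<Sum>j\<in>UNIV. [:A $ i $ j:] * u j) = pcompose (u i) [:1, 1:]"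
      by (simp add: e f u_def pcompose_pCons)
  qed
  have evA: "evp (lin_subst3 A H) u = pcompose (evp H u) [:1, 1:]" for H
    by (simp only: evp_lin_subst3 Au evp_pcompose)
  have "pcompose \<phi> [:1, 1:] = smult c \<phi>"
    using evA[of F] by (simp add: c(2) evp_mult \<phi>_def)
  then have \<phi>0: "degree \<phi> = 0"
    using degree_le_1_if_shift_eigen[of 1 \<phi> 0 c] c(1) by simp
  \<comment> \<open>Differentiate \<open>F(A X) = c F(X)\<close>: the derivative in direction
    \<open>A w\<close> at the shifted point is \<open>c\<close> times the one in direction
    \<open>w\<close>.\<close>
  have \<Psi>A: "pcompose (\<Psi> (A *v w)) [:1, 1:] = smult c (\<Psi> w)" for w
  proof -
    have D: "(\<Sum>j\<in>UNIV. smult (A $ j $ i) (pcompose (evp (pderiv3 j F) u) [:1, 1:]))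
        = smult c (evp (pderiv3 i F) u)" for i
    proof -
      have "evp (pderiv3 i (lin_subst3 A F)) u = evp (pderiv3 i (const3 c * F)) u" by (simp add: c)
      then show ?thesis by (simp add: pderiv3_lin_subst3 evp_sum evp_mult evA pderiv3_mult)
    qed
    have "pcompose (\<Psi> (A *v w)) [:1, 1:] =
        (\<Sum>j\<in>UNIV. \<Sum>i\<in>UNIV. smult (w $ i) (smult (A $ j $ i) (pcompose (evp (pderiv3 j F) u) [:1, 1:])))"
      by (simp add: \<Psi>_def pcompose_sum pcompose_smult matrix_vector_mult_def smult_sum mult.commute)
    also have "\<dots> = (\<Sum>i\<in>UNIV. smult (w $ i) (smult c (evp (pderiv3 i F) u)))"
      by (subst sum.swap) (simp only: D smult_sum_right[symmetric])
    also have "\<dots> = smult c (\<Psi> w)"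
      by (simp add: \<Psi>_def smult_sum_right mult.commute)
    finally show ?thesis .
  qed
  \<comment> \<open>The line has direction \<open>e\<close>, so \<open>\<Psi> e\<close> is the
    derivative of the constant \<open>\<phi>\<close>.\<close>
  have \<Psi>e: "\<Psi> e = 0"
  proof -
    have "pderiv \<phi> = \<Psi> e" by (simp add: \<phi>_def \<Psi>_def pderiv_evp u_def pderiv_pCons)
    moreover obtain k where "\<phi> = [:k:]" using \<phi>0 by (metis degree_eq_zeroE)
    ultimately show ?thesis by (simp add: pderiv_pCons)
  qed
  \<comment> \<open>Euler's identity along the line reads
    \<open>\<Psi> f + t \<Psi> e = d \<phi>\<close>, so \<open>\<Psi> f\<close> is constant.\<close>
  have "(\<Sum>i\<in>UNIV. u i * evp (pderiv3 i F) u) = smult (of_nat d) \<phi>"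
    using arg_cong[OF euler_identity[OF hom], of "\<lambda>H. evp H u"]
    by (simp only: evp_sum evp_mult evp_var evp_const \<phi>_def) simp
  moreover have "(\<Sum>i\<in>UNIV. u i * evp (pderiv3 i F) u) = \<Psi> f + [:0, 1:] * \<Psi> e"
    by (simp add: u_def \<Psi>_def sum_3 smult_add_right algebra_simps)
  ultimately have \<Psi>f: "degree (\<Psi> f) = 0" using \<phi>0 by (simp add: \<Psi>e)
  have "degree (\<Psi> g) \<le> 1"
  proof -
    \<comment> \<open>In this expansion the \<open>e\<close> term contributes nothing and the
      \<open>f\<close> term only a constant, so the shift lemma applies to
      \<open>\<Psi> g\<close>.\<close>
    obtain a b \<gamma> where "A *v g = a *s e + b *s f + \<gamma> *s g"
    proof -
      have "A *v g \<in> vec.span {e, f, g}" using g by simp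
      then show ?thesis using that by (force simp: vec.span_insert algebra_simps)
    qed
    then have "smult \<gamma> (pcompose (\<Psi> g) [:1, 1:]) + pcompose (smult b (\<Psi> f)) [:1, 1:] = smult c (\<Psi> g)"
      using \<Psi>A[of g] by (simp add: \<Psi>_lin \<Psi>e pcompose_add pcompose_smult add.commute)
    moreover obtain k where "\<Psi> f = [:k:]" using \<Psi>f by (metis degree_eq_zeroE)
    ultimately have "smult \<gamma> (pcompose (\<Psi> g) [:1, 1:]) + [:b * k:] = smult c (\<Psi> g)" by simp
    from degree_le_1_if_shift_eigen[OF this c(1)] show ?thesis by (simp split: if_splits)
  qed
  then have top: "coeff (\<Psi> w) (d - 1) = 0" if "w \<in> {e, f, g}" for w
    using that d \<Psi>e \<Psi>f by (auto intro!: coeff_eq_0)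
  have grad: "coeff (\<Psi> w) (d - 1) = (\<Sum>i\<in>UNIV. w $ i * eval3 (pderiv3 i F) e)" for w
    unfolding \<Psi>_def u_def coeff_sum coeff_smult
      evp_line_top_coeff[OF homogeneous3_pderiv3[OF hom]] ..
  have all: "coeff (\<Psi> w) (d - 1) = 0" for w
  proof -
    have "w \<in> vec.span {e, f, g}" using g by simp
    then show ?thesis
      by (induction rule: vec.span_induct_alt) (use top in \<open>auto simp: \<Psi>_lin\<close>, simp add: \<Psi>_def)
  qed
  have "eval3 (pderiv3 i F) e = 0" for i
    using all[of "axis i 1", unfolded grad] by (simp add: axis_def if_distrib if_distribR cong: if_cong)
  \<comment> \<open>The value at \<open>e\<close> is the coefficient of \<open>t^d\<close> in
    \<open>\<phi>\<close>, which is constant while \<open>d > 0\<close>.\<close>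
  moreover have "eval3 F e = 0"
    using evp_line_top_coeff[OF hom, of f e] \<phi>0 d by (simp add: \<phi>_def u_def coeff_eq_0)
  ultimately have "singular_at F e" by (simp add: singular_at_def)
  then show False using F e(1) by (simp add: nonsingular_plane_curve_def)
qed

lemma preserves_mat:
  "homogeneous3 d F \<Longrightarrow> c \<noteq> 0 \<Longrightarrow> preserves (mat c) F"
  using lin_subst3_mat[of d F c] unfolding preserves_def by (intro exI[of _ "c ^ d"]) simp

lemma mat_vector_mult: "mat c *v v = c *s (v :: 'a::field^3)"
  by (simp add: vec_eq_iff matrix_vector_mult_def mat_def if_distrib if_distribR cong: if_cong)

lemma nonsingular_preserves_diagonalizable:
  fixes F :: "'a::{alg_closed_field, field_char_0} poly3"
  assumes d: "d \<ge> 3" and F: "nonsingular_plane_curve d F" and A: "preserves A F" "invertible A"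
  obtains P Q :: "'a^3^3" and \<alpha> :: "3 \<Rightarrow> 'a"
  where "P ** Q = mat 1" "Q ** P = mat 1" "A ** P = P ** diag3 \<alpha>"
proof (cases "vec.span {v. \<exists>l. A *v v = l *s v} = UNIV")
  case True
  then show ?thesis using eigenbasis_diagonalizes that by blast
next
  case False
  have hom: "homogeneous3 d F" using F by (simp add: nonsingular_plane_curve_def)
  obtain l e f where e: "e \<noteq> 0" "A *v e = l *s e" "A *v f = l *s f + e"
    using eigenbasis_or_jordan_chain[OF False] .
  obtain B where B: "B ** A = mat 1" using A(2) by (auto simp: invertible_def)
  have "l \<noteq> 0"
  proof
    assume "l = 0"
    then have "B *v (A *v e) = 0" using e by simp
    then show False using e(1) by (simp add: matrix_vector_mul_assoc B)
  qed
  \<comment> \<open>Dividing \<open>A\<close> by \<open>l\<close> and stretching \<open>f\<close> by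
    \<open>l\<close> turns the Jordan chain into a unipotent one with the same
    \<open>e\<close>.\<close>
  define A' where "A' = mat (inverse l) ** A"
  define f' where "f' = l *s f"
  have "A' *v e = e" "A' *v f' = f' + e"
    using e \<open>l \<noteq> 0\<close>
    by (simp_all add: A'_def f'_def mat_vector_mult vec.scale vec.scale_right_distrib
        flip: matrix_vector_mul_assoc)
  moreover have "preserves A' F"
    unfolding A'_def by (intro preserves_mult A(1) preserves_mat[OF hom]) (use \<open>l \<noteq> 0\<close> in simp)
  moreover obtain g where "vec.span {e, f', g} = UNIV"
    using chain_extends_to_spanning[of e A' 1 f'] calculation(1,2) e(1) by auto
  ultimately show ?thesis using nonsingular_no_unipotent_chain[OF d F] e(1) by blast
qed

section \<open>The order of a diagonal automorphism\<close>

definition cyclic_orders :: "nat \<Rightarrow> nat set" where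
  "cyclic_orders d = {d - 1, d, d^2 - 3*d + 3, (d - 1)^2, d * (d - 2), d * (d - 1)}"

text \<open>With \<open>d = g + 2\<close> the truncated subtractions disappear, and
  \<open>d^2 - 3*d + 3\<close> becomes \<open>(d - 1) * (d - 2) + 1\<close>. For
  \<open>g = 0\<close> truncation would give \<open>3\<close> instead of \<open>1\<close>.\<close>

lemma cyclic_orders_Suc_Suc:
  assumes "g \<ge> 1"
  shows "cyclic_orders (Suc (Suc g)) =
     {Suc g, Suc (Suc g), Suc (Suc g * g), Suc g * Suc g, Suc (Suc g) * g, Suc (Suc g) * Suc g}"
proof -
  have "(Suc (Suc g))\<^sup>2 - 3 * Suc (Suc g) + 3 = Suc (Suc g * g)"
    using assms by (cases g) (simp_all add: power2_eq_square)
  then show ?thesis by (simp add: cyclic_orders_def power2_eq_square)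
qed

section \<open>Power relations for the shapes of \<sigma>, with \<open>g\<close> in the role of
  \<open>d - 2\<close>\<close>

context
  fixes x y z c :: "'a::field" and g :: nat
  assumes nz: "x \<noteq> 0" "y \<noteq> 0" "z \<noteq> 0"
begin

text \<open>Two fixed points, with \<open>z\<close> sent to \<open>x\<close>: \<open>d\<close>-th
  powers agree for \<open>x\<close> and \<open>y\<close>, and \<open>(d - 1)\<close>-th powers for
  \<open>x\<close> and \<open>z\<close>.\<close>

lemma monomial_shape_2_fixed:
  assumes "x ^ Suc g * x = c" "y ^ Suc g * y = c" "z ^ Suc g * x = c"
  shows "x ^ (Suc (Suc g) * Suc g) = y ^ (Suc (Suc g) * Suc g)
    \<and> x ^ (Suc (Suc g) * Suc g) = z ^ (Suc (Suc g) * Suc g)"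
proof -
  have "x ^ Suc (Suc g) = y ^ Suc (Suc g)" using assms by (simp add: mult_ac)
  moreover have "x ^ Suc g = z ^ Suc g" using assms nz by (metis mult_cancel_right)
  ultimately show ?thesis
    by (metis power_mult mult.commute)
qed

text \<open>Here \<open>z\<close> goes to \<open>y\<close> and \<open>y\<close> to the fixed
  \<open>x\<close>. Raise the \<open>z\<close> relation to the power \<open>d - 1\<close> and cancel
  \<open>y ^ (d - 1) = x ^ (d - 1)\<close>.\<close>

lemma monomial_shape_path:
  assumes "x ^ Suc g * x = c" "y ^ Suc g * x = c" "z ^ Suc g * y = c"
  shows "x ^ (Suc g * Suc g) = y ^ (Suc g * Suc g) \<and> x ^ (Suc g * Suc g) = z ^ (Suc g * Suc g)"
proof -
  define e where "e = Suc g"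
  have xy: "x ^ e = y ^ e" using assms nz unfolding e_def by (metis mult_cancel_right)
  have "(z ^ e * y) ^ e = (x ^ e * x) ^ e" using assms unfolding e_def by simp
  then have "z ^ (e * e) * y ^ e = x ^ (e * e) * x ^ e"
    by (simp only: power_mult_distrib power_mult)
  then show ?thesis using xy nz unfolding e_def[symmetric] by (simp add: power_mult)
qed

text \<open>With \<open>e = d - 1\<close>, raise the \<open>y\<close> relation to the power
  \<open>e\<close> and multiply by \<open>y\<close>; the \<open>z\<close> relation then eliminates
  \<open>z\<close>, leaving the exponent \<open>e * e - 1 = d * (d - 2)\<close>. Exchanging
  \<open>y\<close> and \<open>z\<close> treats the other entry.\<close>

lemma monomial_shape_fixed_swap:
  assumes "x ^ Suc g * x = c" "y ^ Suc g * z = c" "z ^ Suc g * y = c"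
  shows "x ^ (Suc (Suc g) * g) = y ^ (Suc (Suc g) * g)"
proof -
  define e N where "e = Suc g" and "N = Suc (Suc g) * g"
  have N: "e * e = Suc N" by (simp add: e_def N_def)
  have a: "x ^ e * x = c" "y ^ e * z = c" "z ^ e * y = c" using assms by (simp_all add: e_def)
  have "(y ^ e * z) ^ e * y = (x ^ e * x) ^ e * y" using a by simp
  then have "y ^ (e * e) * (z ^ e * y) = x ^ (e * e) * x ^ e * y"
    by (simp only: power_mult_distrib power_mult mult.assoc)
  then have "y ^ (e * e) * (x ^ e * x) = x ^ (e * e) * x ^ e * y" using a by simp
  then have "y ^ N * y * x ^ e * x = x ^ N * y * x ^ e * x" by (simp add: N mult_ac)
  then show ?thesis using nz unfolding N_def[symmetric] by simp
qed

text \<open>With \<open>e = d - 1\<close>, raise the \<open>z\<close> relation to the power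
  \<open>e\<close> and multiply by \<open>y\<close>; the \<open>x\<close> relation then eliminates
  \<open>x\<close>, leaving \<open>e * e + 1 - e = d^2 - 3*d + 3\<close>. Cyclic rotation gives the
  other equality.\<close>

lemma monomial_shape_cycle:
  assumes "x ^ Suc g * y = c" "y ^ Suc g * z = c" "z ^ Suc g * x = c"
  shows "y ^ Suc (Suc g * g) = z ^ Suc (Suc g * g)"
proof -
  define e N where "e = Suc g" and "N = Suc (Suc g * g)"
  have N: "N + e = Suc (e * e)" by (simp add: e_def N_def)
  have a: "x ^ e * y = c" "y ^ e * z = c" "z ^ e * x = c" using assms by (simp_all add: e_def)
  have "(z ^ e * x) ^ e * y = (y ^ e * z) ^ e * y" using a by simp
  then have "z ^ (e * e) * (x ^ e * y) = y ^ (e * e) * y * z ^ e"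
    by (simp only: power_mult_distrib power_mult mult_ac)
  then have "z ^ (e * e) * (y ^ e * z) = y ^ (e * e) * y * z ^ e" using a by simp
  then have "z ^ Suc (e * e) * y ^ e = y ^ Suc (e * e) * z ^ e" by (simp add: mult_ac)
  then have "z ^ N * z ^ e * y ^ e = y ^ N * y ^ e * z ^ e"
    by (simp only: N[symmetric] power_add)
  then show ?thesis using nz unfolding N_def[symmetric] by simp
qed

text \<open>The shape without a pure power: the extra monomial in \<open>y\<close> and \<open>z\<close> rules out the order
  \<open>(d - 1) * (d - 2)\<close> that the first three relations alone would permit.\<close>

lemma monomial_shape_swap_tail:
  assumes "x ^ Suc g * y = c" "y ^ Suc g * x = c" "z ^ Suc g * x = c"
    and "y ^ a * z ^ b = c" "a + b = Suc (Suc g)"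
  shows "x ^ Suc g = y ^ Suc g \<and> x ^ Suc g = z ^ Suc g"
proof -
  define e where "e = Suc g"
  have yz: "z ^ e = y ^ e" using assms(2,3) nz unfolding e_def by (metis mult_cancel_right)
  \<comment> \<open>Since \<open>z ^ e = y ^ e\<close>, the \<open>e\<close>-th power of the extra
    monomial depends only on \<open>a + b\<close>.\<close>
  have "(y ^ a * z ^ b) ^ e = (y ^ e * x) ^ e" using assms by (simp add: e_def)
  then have "(y ^ e) ^ a * (z ^ e) ^ b = (y ^ e) ^ e * x ^ e"
    by (simp only: power_mult_distrib power_mult[symmetric] mult.commute)
  moreover have "a + b = Suc e" using assms(5) by (simp add: e_def)
  ultimately have "(y ^ e) ^ Suc e = (y ^ e) ^ e * x ^ e"
    by (simp only: yz power_add[symmetric])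
  then have "y ^ e = x ^ e" using nz by simp
  then show ?thesis using yz unfolding e_def[symmetric] by simp
qed

end

lemma monomial_relations_order:
  fixes \<alpha> :: "3 \<Rightarrow> 'a::field"
  assumes "d \<ge> 3" and nz: "\<And>i. \<alpha> i \<noteq> 0"
    and vertex: "\<And>i. \<exists>j. \<alpha> i ^ (d - 1) * \<alpha> j = c"
    and edge: "\<And>i j k. UNIV = {i, j, k} \<Longrightarrow> \<exists>a b. a + b = d \<and> \<alpha> j ^ a * \<alpha> k ^ b = c"
  shows "\<exists>n\<in>cyclic_orders d. \<forall>i j. \<alpha> i ^ n = \<alpha> j ^ n"
proof -
  define g where "g = d - 2"
  have d: "d = Suc (Suc g)" using \<open>d \<ge> 3\<close> by (simp add: g_def)
  \<comment> \<open>\<open>R i j\<close> is the relation imposed by the monomial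
    \<open>x_i^(d-1) x_j\<close>, that is, by \<sigma> sending \<open>i\<close> to
    \<open>j\<close>.\<close>
  define R where "R i j \<longleftrightarrow> \<alpha> i ^ Suc g * \<alpha> j = c" for i j
  define C where "C \<longleftrightarrow> (\<exists>n\<in>cyclic_orders d. \<forall>i j. \<alpha> i ^ n = \<alpha> j ^ n)"
  have C: C if "UNIV = {i, j, k}" "n \<in> cyclic_orders d" "\<alpha> i ^ n = \<alpha> j ^ n \<and> \<alpha> i ^ n = \<alpha> k ^ n" for i j k n
  proof -
    have "\<alpha> l ^ n = \<alpha> i ^ n" for l
    proof -
      have "l \<in> {i, j, k}" unfolding that(1)[symmetric] by simp
      then show ?thesis using that(3) by auto
    qed
    then show ?thesis using that(2) unfolding C_def by metis
  qed
  have ord: "cyclic_orders d =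
     {Suc g, Suc (Suc g), Suc (Suc g * g), Suc g * Suc g, Suc (Suc g) * g, Suc (Suc g) * Suc g}"
    unfolding d by (rule cyclic_orders_Suc_Suc) (use \<open>d \<ge> 3\<close> in \<open>simp add: g_def\<close>)
  have mem: "Suc g \<in> cyclic_orders d" "Suc (Suc g * g) \<in> cyclic_orders d" "Suc (Suc g) * g \<in> cyclic_orders d"
    unfolding ord by blast+
  \<comment> \<open>The seven shapes in turn: identity; two fixed points; a constant map; a path
    into a fixed point; a fixed point and a swap; a three-cycle; a swap with a tail.\<close>
  have s1: C if u: "UNIV = {i, j, k}" and "R i i" "R j j" "R k k" for i j k
    by (rule C[OF u, of "Suc (Suc g)"]) (use that in \<open>auto simp: ord R_def mult_ac\<close>)
  have s2: C if u: "UNIV = {i, j, k}" and "R i i" "R j j" "R k i" for i j k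
    by (rule C[OF u _ monomial_shape_2_fixed[where c = c]]) (use that nz in \<open>simp_all add: ord R_def\<close>)
  have s3: C if u: "UNIV = {i, j, k}" and "R i i" "R j i" "R k i" for i j k
    by (rule C[OF u, of "Suc g"]) (use that nz[of i] in \<open>auto simp: ord R_def simp del: power_Suc\<close>)
  have s4: C if u: "UNIV = {i, j, k}" and "R i i" "R j i" "R k j" for i j k
    by (rule C[OF u _ monomial_shape_path[where c = c]]) (use that nz in \<open>simp_all add: ord R_def\<close>)
  have s5: C if u: "UNIV = {i, j, k}" and "R i i" "R j k" "R k j" for i j k
  proof -
    have "\<alpha> i ^ (Suc (Suc g) * g) = \<alpha> j ^ (Suc (Suc g) * g)"
      "\<alpha> i ^ (Suc (Suc g) * g) = \<alpha> k ^ (Suc (Suc g) * g)"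
      by (rule monomial_shape_fixed_swap[OF nz nz nz that(2,3,4)[unfolded R_def]]
          monomial_shape_fixed_swap[OF nz nz nz that(2,4,3)[unfolded R_def]])+
    then show C by (intro C[OF u mem(3)]) simp
  qed
  have s6: C if "UNIV = {i, j, k}" "R i j" "R j k" "R k i" for i j k
  proof -
    have "\<alpha> j ^ Suc (Suc g * g) = \<alpha> k ^ Suc (Suc g * g)" "\<alpha> k ^ Suc (Suc g * g) = \<alpha> i ^ Suc (Suc g * g)"
      by (rule monomial_shape_cycle[OF nz nz nz that(2,3,4)[unfolded R_def]]
          monomial_shape_cycle[OF nz nz nz that(3,4,2)[unfolded R_def]])+
    then show C by (intro C[OF that(1) mem(2)]) simp
  qed
  have s7: C if u: "UNIV = {i, j, k}" and "R i j" "R j i" "R k i" for i j k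
  proof -
    obtain a b where ab: "a + b = d" "\<alpha> j ^ a * \<alpha> k ^ b = c" using edge[OF u] by blast
    then have "\<alpha> i ^ Suc g = \<alpha> j ^ Suc g \<and> \<alpha> i ^ Suc g = \<alpha> k ^ Suc g"
      by (intro monomial_shape_swap_tail[OF nz nz nz that(2,3,4)[unfolded R_def] ab(2) ab(1)[unfolded d]])
    then show C by (rule C[OF u mem(1)])
  qed
  have R: "R i 1 \<or> R i 2 \<or> R i 3" for i
    using vertex[of i] exhaust_3 unfolding R_def d diff_Suc_1 by metis
  have perms: "UNIV = {1, 2, 3 :: 3}" "UNIV = {1, 3, 2 :: 3}" "UNIV = {2, 1, 3 :: 3}"
    "UNIV = {2, 3, 1 :: 3}" "UNIV = {3, 1, 2 :: 3}" "UNIV = {3, 2, 1 :: 3}"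
    using UNIV_3 by auto
  note shapes = perms[THEN s1] perms[THEN s2] perms[THEN s3] perms[THEN s4] perms[THEN s5]
    perms[THEN s6] perms[THEN s7]
  \<comment> \<open>Each of the 27 possible maps is one of the seven shapes after
    relabelling.\<close>
  have C using R[of 1] R[of 2] R[of 3]
    by (elim disjE) (blast intro: shapes)+
  then show ?thesis by (simp add: C_def)
qed

section \<open>Diagonal substitutions and the monomials forced by non-singularity\<close>

lemma lookup_lin_subst3_diag3:
  fixes F :: "'a::field poly3"
  shows "Poly_Mapping.lookup (lin_subst3 (diag3 \<alpha>) F) m =
    (\<Prod>i\<in>UNIV. \<alpha> i ^ Poly_Mapping.lookup m i) * Poly_Mapping.lookup F m"
proof -
  have l: "(\<Sum>j\<in>UNIV. const3 (diag3 \<alpha> $ i $ j) * var3 j) = const3 (\<alpha> i) * var3 i" for i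
  proof -
    have "(\<Sum>j\<in>UNIV. const3 (diag3 \<alpha> $ i $ j) * var3 j)
        = (\<Sum>j\<in>UNIV. if i = j then const3 (\<alpha> i) * var3 j else 0)"
      by (rule sum.cong) (auto simp: diag3_def const3_def)
    then show ?thesis by simp
  qed
  have s: "lin_subst3 (diag3 \<alpha>) (Poly_Mapping.single n a) =
      Poly_Mapping.single n ((\<Prod>i\<in>UNIV. \<alpha> i ^ Poly_Mapping.lookup n i) * a)" for n a
    unfolding lin_subst3_single l
    by (simp add: single_eq_const3_times_vars[of n "_ * _"] power_mult_distrib prod.distrib
        const3_mult const3_power const3_prod mult_ac)
  have "lin_subst3 (diag3 \<alpha>) F = (\<Sum>n \<in> Poly_Mapping.keys F. Poly_Mapping.single n
      ((\<Prod>i\<in>UNIV. \<alpha> i ^ Poly_Mapping.lookup n i) * Poly_Mapping.lookup F n))"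
    by (subst poly3_decomp[of F]) (simp only: lin_subst3_sum s)
  then show ?thesis
    by (auto simp: Poly_Mapping.lookup_sum lookup_single when_def in_keys_iff if_distrib sum.delta' cong: if_cong)
qed

text \<open>At the \<open>i\<close>-th coordinate point a monomial is nonzero only if it is a power
  of \<open>x_i\<close>, so a nonzero value or derivative of \<open>F\<close> there exhibits
  \<open>x_i^(d-1) x_j\<close>. The choice \<open>j = i\<close> encodes the pure power.\<close>

lemma nonsingular_vertex_monomial:
  fixes F :: "'a::field poly3"
  assumes F: "nonsingular_plane_curve d F" and d: "d \<ge> 1"
  obtains m j where "m \<in> Poly_Mapping.keys F"
    "\<And>k. Poly_Mapping.lookup m k = (if k = i then d - 1 else 0) + (if k = j then 1 else 0)"
proof -
  have "(axis i 1 :: 'a^3) \<noteq> 0" by (simp add: axis_eq_0_iff)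
  then have ns: "\<not> singular_at F (axis i 1)" using F by (simp add: nonsingular_plane_curve_def)
  have mon: "(\<Prod>k\<in>UNIV. ((axis i 1 :: 'a^3) $ k) ^ e k) = 0" if "e k \<noteq> 0" "k \<noteq> i" for e :: "3 \<Rightarrow> nat" and k
    using that by (intro prod_zero) (auto intro!: bexI[of _ k] simp: axis_def)
  have sum: "(\<Sum>k\<in>UNIV. Poly_Mapping.lookup m k) = d" if "m \<in> Poly_Mapping.keys F" for m
    using F that by (simp add: nonsingular_plane_curve_def homogeneous3_def)
  have lookup_i: "Poly_Mapping.lookup m i = d - (\<Sum>k\<in>UNIV - {i}. Poly_Mapping.lookup m k)"
    if "m \<in> Poly_Mapping.keys F" for m
    using sum[OF that] sum.remove[of UNIV i "Poly_Mapping.lookup m"] by simp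
  consider "eval3 F (axis i 1) \<noteq> 0" | j where "eval3 (pderiv3 j F) (axis i 1) \<noteq> 0"
    using ns by (auto simp: singular_at_def)
  then show ?thesis
  proof cases
    case 1
    then obtain m where m: "m \<in> Poly_Mapping.keys F"
      "(\<Prod>k\<in>UNIV. ((axis i 1 :: 'a^3) $ k) ^ Poly_Mapping.lookup m k) \<noteq> 0"
      unfolding eval3_def by (metis (no_types, lifting) mult_zero_right sum.neutral)
    have z: "Poly_Mapping.lookup m k = 0" if "k \<noteq> i" for k using mon m(2) that by blast
    then have "Poly_Mapping.lookup m i = d" using lookup_i[OF m(1)] by simp
    then show ?thesis using that[OF m(1), of i] z d by auto
  next
    case (2 j)
    then obtain m where m: "m \<in> Poly_Mapping.keys F" "of_nat (Poly_Mapping.lookup m j) \<noteq> (0::'a)"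
      "(\<Prod>k\<in>UNIV. ((axis i 1 :: 'a^3) $ k) ^ Poly_Mapping.lookup (m - Poly_Mapping.single j 1) k) \<noteq> 0"
      unfolding pderiv3_def eval3_sum eval3_single
      by (metis (no_types, lifting) mult_zero_right mult_zero_left sum.neutral)
    have mj: "Poly_Mapping.lookup m j \<noteq> 0" using m(2) by (metis of_nat_0)
    have z': "Poly_Mapping.lookup (m - Poly_Mapping.single j 1) k = 0" if "k \<noteq> i" for k
      using mon m(3) that by blast
    have z: "Poly_Mapping.lookup m k = (if k = j then 1 else 0)" if "k \<noteq> i" for k
      using mj z'[OF that] by (auto simp: lookup_minus lookup_single when_def split: if_splits)
    have "(\<Sum>k\<in>UNIV - {i}. Poly_Mapping.lookup m k) = (\<Sum>k\<in>UNIV - {i}. if k = j then 1 else 0)"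
      by (rule sum.cong) (auto simp: z)
    then have "(\<Sum>k\<in>UNIV - {i}. Poly_Mapping.lookup m k) = (if j = i then 0 else 1)" by simp
    then have "Poly_Mapping.lookup m i = (if j = i then d else d - 1)"
      using lookup_i[OF m(1)] by simp
    then show ?thesis using that[OF m(1), of j] z d by auto
  qed
qed

text \<open>If \<open>F\<close> does not vanish at \<open>e\<close>, its restriction to the line has
  a nonzero coefficient of \<open>t^n\<close>, hence positive degree and a root.\<close>

lemma homogeneous3_zero_on_line:
  fixes F :: "'a::alg_closed_field poly3"
  assumes F: "homogeneous3 n F" and n: "n \<ge> 1"
  shows "eval3 F e = 0 \<or> (\<exists>t. eval3 F (f + t *s e) = 0)"
proof (cases "eval3 F e = 0")
  case False
  let ?p = "evp F (\<lambda>i. [:f $ i, e $ i:])"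
  have "coeff ?p n \<noteq> 0" using evp_line_top_coeff[OF F, of f e] False by simp
  then have "degree ?p > 0" using le_degree n by fastforce
  then obtain t where "poly ?p t = 0" using alg_closed_imp_poly_has_root by blast
  moreover have "(\<chi> i. f $ i + t * e $ i) = f + t *s e" by (simp add: vec_eq_iff)
  ultimately show ?thesis by (auto simp: poly_evp)
qed simp

text \<open>Otherwise the line on which the \<open>i\<close>-th coordinate vanishes is a component of the curve, and
  the curve is singular where the line meets the residual component.\<close>

lemma nonsingular_monomial_avoiding_variable:
  fixes F :: "'a::alg_closed_field poly3"
  assumes F: "nonsingular_plane_curve d F" and d: "d \<ge> 2"
  shows "\<exists>m\<in>Poly_Mapping.keys F. Poly_Mapping.lookup m i = 0"
proof (rule ccontr)
  assume "\<not> ?thesis"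
  then have div: "Poly_Mapping.lookup m i \<noteq> 0" if "m \<in> Poly_Mapping.keys F" for m using that by metis
  obtain j k where jk: "i \<noteq> j" "i \<noteq> k" "j \<noteq> k"
  proof -
    have "card (UNIV - {i}) = 2" by (simp add: card_Diff_singleton)
    then obtain j k where "UNIV - {i} = {j, k}" "j \<noteq> k" unfolding card_2_iff by blast
    then show ?thesis using that[of j k] by blast
  qed
  \<comment> \<open>For \<open>F = x_i H\<close>, the derivative by \<open>x_i\<close> restricts to
    \<open>H\<close> on the line \<open>x_i = 0\<close>, so its zero there lies on the residual
    component.\<close>
  obtain v :: "'a^3" where v: "v $ i = 0" "v \<noteq> 0" "eval3 (pderiv3 i F) v = 0"
  proof -
    have h: "homogeneous3 (d - 1) (pderiv3 i F)"
      using F by (intro homogeneous3_pderiv3) (simp add: nonsingular_plane_curve_def)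
    have nz: "(axis k 1 :: 'a^3) \<noteq> 0" "axis j 1 + t *s (axis k 1 :: 'a^3) \<noteq> 0" for t
    proof -
      show "(axis k 1 :: 'a^3) \<noteq> 0" by (simp add: axis_eq_0_iff)
      have "(axis j 1 + t *s (axis k 1 :: 'a^3)) $ j = 1" using jk by (simp add: axis_def)
      then show "axis j 1 + t *s (axis k 1 :: 'a^3) \<noteq> 0" by (metis zero_index zero_neq_one)
    qed
    have "d - 1 \<ge> 1" using d by simp
    from homogeneous3_zero_on_line[OF h this, of "axis k 1" "axis j 1"]
    consider "eval3 (pderiv3 i F) (axis k 1) = 0"
      | t where "eval3 (pderiv3 i F) (axis j 1 + t *s axis k 1) = 0" by blast
    then show ?thesis
    proof cases
      case 1
      then show ?thesis using jk by (intro that[OF _ nz(1)]) (simp_all add: axis_def)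
    next
      case 2
      then show ?thesis using jk by (intro that[OF _ nz(2)]) (simp_all add: axis_def)
    qed
  qed
  have zero: "(\<Prod>k\<in>UNIV. (v $ k) ^ e k) = 0" if "e i \<noteq> 0" for e :: "3 \<Rightarrow> nat"
    using that v(1) by (intro prod_zero) (auto intro!: bexI[of _ i])
  have "eval3 F v = 0"
    unfolding eval3_def by (rule sum.neutral) (auto simp: zero div)
  moreover have "eval3 (pderiv3 l F) v = 0" for l
  proof (cases "l = i")
    case False
    then show ?thesis
      unfolding pderiv3_def eval3_sum eval3_single
      by (intro sum.neutral) (auto simp: zero div lookup_minus lookup_single)
  qed (simp add: v)
  ultimately have "singular_at F v" by (simp add: singular_at_def)
  then show False using F v by (simp add: nonsingular_plane_curve_def)
qed

text \<open>Comparing coefficients shows that every monomial of \<open>F\<close> takes the value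
  \<open>c\<close> at \<open>\<alpha>\<close>; the vertex monomials and those avoiding a variable
  give the required relations.\<close>

lemma nonsingular_diag3_order:
  fixes F :: "'a::alg_closed_field poly3"
  assumes d: "d \<ge> 3" and F: "nonsingular_plane_curve d F" and D: "preserves (diag3 \<alpha>) F"
    and nz: "\<And>i. \<alpha> i \<noteq> 0"
  shows "\<exists>n\<in>cyclic_orders d. \<forall>i j. \<alpha> i ^ n = \<alpha> j ^ n"
proof -
  obtain c where c: "lin_subst3 (diag3 \<alpha>) F = const3 c * F" using D by (auto simp: preserves_def)
  have rel: "(\<Prod>i\<in>UNIV. \<alpha> i ^ Poly_Mapping.lookup m i) = c" if m: "m \<in> Poly_Mapping.keys F" for m
  proof -
    have "Poly_Mapping.lookup (const3 c * F) m = c * Poly_Mapping.lookup F m"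
    proof -
      have "const3 c * F = (\<Sum>n \<in> Poly_Mapping.keys F. Poly_Mapping.single n (c * Poly_Mapping.lookup F n))"
        by (subst poly3_decomp[of F]) (simp add: sum_distrib_left const3_def mult_single)
      then show ?thesis
        by (auto simp: Poly_Mapping.lookup_sum lookup_single when_def in_keys_iff if_distrib sum.delta' cong: if_cong)
    qed
    then show ?thesis
      using m lookup_lin_subst3_diag3[of \<alpha> F m] by (simp add: c in_keys_iff)
  qed
  show ?thesis
  proof (rule monomial_relations_order[OF d nz])
    fix i
    have "d \<ge> 1" using d by simp
    obtain m j where m: "m \<in> Poly_Mapping.keys F"
      "\<And>k. Poly_Mapping.lookup m k = (if k = i then d - 1 else 0) + (if k = j then 1 else 0)"
      by (rule nonsingular_vertex_monomial[OF F \<open>d \<ge> 1\<close>, of i]) blast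
    have "(\<Prod>k\<in>UNIV. \<alpha> k ^ Poly_Mapping.lookup m k) =
        (\<Prod>k\<in>UNIV. (if k = i then \<alpha> k ^ (d - 1) else 1) * (if k = j then \<alpha> k else 1))"
      by (rule prod.cong) (auto simp: m(2) power_add)
    also have "\<dots> = \<alpha> i ^ (d - 1) * \<alpha> j" by (simp add: prod.distrib)
    finally show "\<exists>j. \<alpha> i ^ (d - 1) * \<alpha> j = c" using rel[OF m(1)] by auto
  next
    fix i j k :: 3
    assume u: "UNIV = {i, j, k}"
    have "card {i, j, k} = 3" unfolding u[symmetric] by simp
    then have ne: "i \<noteq> j" "i \<noteq> k" "j \<noteq> k" by (auto simp: card_insert_if split: if_splits)
    obtain m where m: "m \<in> Poly_Mapping.keys F" "Poly_Mapping.lookup m i = 0"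
      using nonsingular_monomial_avoiding_variable[OF F, of i] d by auto
    have "(\<Sum>k\<in>UNIV. Poly_Mapping.lookup m k) = d"
      using F m(1) by (simp add: nonsingular_plane_curve_def homogeneous3_def)
    then have "Poly_Mapping.lookup m j + Poly_Mapping.lookup m k = d"
      unfolding u using ne m(2) by simp
    moreover have "\<alpha> j ^ Poly_Mapping.lookup m j * \<alpha> k ^ Poly_Mapping.lookup m k = c"
      using rel[OF m(1)] unfolding u using ne m(2) by simp
    ultimately show "\<exists>a b. a + b = d \<and> \<alpha> j ^ a * \<alpha> k ^ b = c" by blast
  qed
qed

section \<open>Passage to orders in \<open>GL3\<close> modulo scalars and in
  \<open>PGL3\<close>\<close>

lemma diag3_mult: "diag3 \<alpha> ** diag3 \<beta> = diag3 (\<lambda>i. \<alpha> i * \<beta> i :: 'a::field)"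
proof -
  have "(\<Sum>k\<in>UNIV. diag3 \<alpha> $ i $ k * diag3 \<beta> $ k $ j) = diag3 (\<lambda>i. \<alpha> i * \<beta> i) $ i $ j" for i j
  proof -
    have "(\<Sum>k\<in>UNIV. diag3 \<alpha> $ i $ k * diag3 \<beta> $ k $ j) =
        (\<Sum>k\<in>UNIV. if i = k then diag3 (\<lambda>i. \<alpha> i * \<beta> i) $ k $ j else 0)"
      by (rule sum.cong) (auto simp: diag3_def)
    then show ?thesis by simp
  qed
  then show ?thesis by (simp add: vec_eq_iff matrix_matrix_mult_def)
qed

lemma nonsingular_automorphism_order:
  fixes F :: "'a::{alg_closed_field, field_char_0} poly3"
  assumes d: "d \<ge> 3" and F: "nonsingular_plane_curve d F" and A: "preserves A F" "A \<in> carrier GL3"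
  shows "\<exists>n\<in>cyclic_orders d. A [^]\<^bsub>GL3\<^esub> n \<in> scalars3"
proof -
  interpret GL: group "GL3 :: ('a^3^3) monoid" by (rule group_GL3)
  have hom: "homogeneous3 d F" using F by (simp add: nonsingular_plane_curve_def)
  have invA: "invertible A" using A(2) by (simp add: GL3_def)
  obtain P Q :: "'a^3^3" and \<alpha> where PQ: "P ** Q = mat 1" "Q ** P = mat 1" and AP: "A ** P = P ** diag3 \<alpha>"
    using nonsingular_preserves_diagonalizable[OF d F A(1) invA] .
  \<comment> \<open>The equation in eigenbasis coordinates;
    \<open>A ** P = P ** diag3 \<alpha>\<close> makes the diagonal matrix preserve it.\<close>
  define G where "G = lin_subst3 P F"
  have G: "nonsingular_plane_curve d G" unfolding G_def by (rule nonsingular_lin_subst3[OF F PQ(1)])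
  obtain c where c: "c \<noteq> 0" "lin_subst3 A F = const3 c * F" using A(1) by (auto simp: preserves_def)
  have "lin_subst3 (diag3 \<alpha>) G = lin_subst3 P (lin_subst3 A F)"
    by (simp add: G_def lin_subst3_lin_subst3 AP)
  also have "\<dots> = const3 c * G" by (simp add: c G_def lin_subst3_mult)
  finally have D: "preserves (diag3 \<alpha>) G" using c(1) by (auto simp: preserves_def)
  have nz: "\<alpha> i \<noteq> 0" for i
  proof
    assume "\<alpha> i = 0"
    then have "diag3 \<alpha> *v axis i 1 = 0"
      by (auto simp: vec_eq_iff matrix_vector_mult_def diag3_def axis_def if_distrib if_distribR cong: if_cong)
    moreover obtain B where B: "B ** A = mat 1" using invA by (auto simp: invertible_def)
    \<comment> \<open>A left inverse of the diagonal matrix, which therefore cannot kill a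
      coordinate vector.\<close>
    have "Q ** B ** P ** diag3 \<alpha> = Q ** (B ** A) ** P" by (simp add: AP[symmetric] flip: matrix_mul_assoc)
    then have "Q ** B ** P ** diag3 \<alpha> = mat 1" by (simp add: B PQ)
    ultimately have "(axis i 1 :: 'a^3) = 0"
      by (metis matrix_vector_mul_assoc matrix_vector_mul_lid matrix_vector_mult_0_right)
    then show False by (simp add: axis_eq_0_iff)
  qed
  obtain n where n: "n \<in> cyclic_orders d" "\<And>i j. \<alpha> i ^ n = \<alpha> j ^ n"
    using nonsingular_diag3_order[OF d G D nz] by auto
  have pow: "A [^]\<^bsub>GL3\<^esub> m ** P = P ** diag3 (\<lambda>i. \<alpha> i ^ m)" for m :: nat
  proof (induction m)
    case 0
    have "diag3 (\<lambda>i. 1 :: 'a) = mat 1" by (simp add: diag3_def mat_def)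
    then show ?case by (simp add: GL3_def)
  next
    case (Suc m)
    have "A [^]\<^bsub>GL3\<^esub> Suc m ** P = A [^]\<^bsub>GL3\<^esub> m ** (A ** P)"
      by (simp add: GL3_def matrix_mul_assoc)
    also have "\<dots> = P ** (diag3 (\<lambda>i. \<alpha> i ^ m) ** diag3 \<alpha>)" by (simp add: AP matrix_mul_assoc Suc)
    finally show ?case by (simp add: diag3_mult mult.commute)
  qed
  have "diag3 (\<lambda>i. \<alpha> i ^ n) = mat (\<alpha> 1 ^ n)"
    using n(2)[of _ 1] by (simp add: diag3_def mat_def vec_eq_iff)
  then have "A [^]\<^bsub>GL3\<^esub> n ** P = mat (\<alpha> 1 ^ n) ** P" using pow[of n] by (simp add: mat_commute)
  then have "A [^]\<^bsub>GL3\<^esub> n ** (P ** Q) = mat (\<alpha> 1 ^ n) ** (P ** Q)"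
    by (simp add: matrix_mul_assoc)
  then have "A [^]\<^bsub>GL3\<^esub> n = mat (\<alpha> 1 ^ n)" by (simp add: PQ(1))
  then have "A [^]\<^bsub>GL3\<^esub> n \<in> scalars3"
    using nz[of 1] unfolding scalars3_def by (intro CollectI exI[of _ "\<alpha> 1 ^ n"]) simp
  then show ?thesis using n(1) by blast
qed

text \<open>The matrix power lies both in the coset \<open>x^n\<close> and in the trivial coset, and
  distinct cosets are disjoint.\<close>

lemma PGL3_pow_eq_one:
  fixes x :: "('a::field^3^3) set"
  assumes x: "x \<in> carrier PGL3" "A \<in> x" and n: "A [^]\<^bsub>GL3\<^esub> (n::nat) \<in> scalars3"
  shows "x [^]\<^bsub>PGL3\<^esub> n = \<one>\<^bsub>PGL3\<^esub>"
proof -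
  interpret GL: group "GL3 :: ('a^3^3) monoid" by (rule group_GL3)
  interpret N: normal scalars3 "GL3 :: ('a^3^3) monoid" by (rule scalars3_normal)
  interpret PGL: group "PGL3 :: ('a^3^3) set monoid" by (rule group_PGL3)
  have one: "\<one>\<^bsub>PGL3\<^esub> = (scalars3 :: ('a^3^3) set)" by (simp add: PGL3_def FactGroup_def)
  have mem: "A [^]\<^bsub>GL3\<^esub> m \<in> x [^]\<^bsub>PGL3\<^esub> m" for m :: nat
  proof (induction m)
    case 0
    then show ?case by (simp add: one GL.nat_pow_0 N.one_closed)
  next
    case (Suc m)
    then show ?case using x(2) by (auto simp: PGL3_def FactGroup_def set_mult_def)
  qed
  have "x [^]\<^bsub>PGL3\<^esub> n \<in> rcosets\<^bsub>GL3\<^esub> scalars3" "scalars3 \<in> rcosets\<^bsub>GL3\<^esub> (scalars3 :: ('a^3^3) set)"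
    using PGL.nat_pow_closed[OF x(1)] PGL.one_closed unfolding one by (auto simp: PGL3_def FactGroup_def)
  then show ?thesis
    using GL.rcos_disjoint[OF scalars3_subgroup] mem[of n] n unfolding one
    by (auto simp: pairwise_def disjnt_def)
qed

lemma carrier_PGL3_subset: "x \<in> carrier PGL3 \<Longrightarrow> A \<in> x \<Longrightarrow> A \<in> carrier (GL3 :: ('a::field^3^3) monoid)"
  using subgroup.rcosets_carrier[OF scalars3_subgroup group_GL3] by (auto simp: PGL3_def FactGroup_def)

text \<open>Positivity is what lets divisibility yield the bound on the group order.\<close>

lemma cyclic_orders_pos_le:
  assumes "d \<ge> 3" "n \<in> cyclic_orders d"
  shows "0 < n" "n \<le> d * (d - 1)"
proof -
  obtain g where "d = 3 + g" using le_Suc_ex[OF assms(1)] by blast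
  then have d: "d = Suc (Suc (Suc g))" by simp
  show "0 < n" "n \<le> d * (d - 1)"
    using assms(2) by (auto simp: d cyclic_orders_Suc_Suc)
qed

theorem corollary33:
  fixes F :: "('k::{alg_closed_field, field_char_0}) poly3"
    and d :: nat
    and G :: "('k^3^3) set set"
  assumes "d \<ge> 4"
    and "nonsingular_plane_curve d F"
    and "subgroup G (Aut F)"
    and "cyclic_group ((Aut F)\<lparr>carrier := G\<rparr>)"
  shows "(\<exists>n \<in> {d - 1, d, d^2 - 3*d + 3, (d - 1)^2, d * (d - 2), d * (d - 1)}. card G dvd n)
       \<and> card G \<le> d * (d - 1)"
proof -
  have hom: "homogeneous3 d F" using assms(2) by (simp add: nonsingular_plane_curve_def)
  let ?H = "(Aut F)\<lparr>carrier := G\<rparr>"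
  interpret H: group ?H
    by (rule subgroup.subgroup_is_group[OF assms(3) group_Aut[OF hom]])
  obtain x where x: "x \<in> G" "subgroup_generated ?H {x} = ?H"
    using assms(4) by (auto simp: cyclic_group_def)
  have "generate ?H {x} = G"
    using arg_cong[OF x(2), of carrier] x(1) by (simp add: carrier_subgroup_generated)
  then have card: "card G = group.ord ?H x" using H.generate_pow_card[of x] x(1) by simp
  have "x \<in> carrier (Aut F)" using x(1) subgroup.subset[OF assms(3)] by blast
  then obtain A where A: "x \<in> carrier PGL3" "A \<in> x" "preserves A F" by (auto simp: Aut_def)
  obtain n where n: "n \<in> cyclic_orders d" "A [^]\<^bsub>GL3\<^esub> n \<in> scalars3"
    using nonsingular_automorphism_order[OF _ assms(2) A(3) carrier_PGL3_subset[OF A(1,2)]] assms(1) by auto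
  \<comment> \<open>Passing to \<open>Aut F\<close> and to \<open>G\<close> changes only the
    carrier, so powers and the unit are those of \<open>PGL3\<close>.\<close>
  have "x [^]\<^bsub>?H\<^esub> n = x [^]\<^bsub>PGL3\<^esub> n"
    by (simp add: Aut_def nat_pow_def)
  also have "\<dots> = \<one>\<^bsub>?H\<^esub>" using PGL3_pow_eq_one[OF A(1,2) n(2)] by (simp add: Aut_def)
  finally have dvd: "card G dvd n" unfolding card using H.pow_eq_id[of x n] x(1) by simp
  moreover have "card G \<le> d * (d - 1)"
    using dvd_imp_le[OF dvd] cyclic_orders_pos_le[OF _ n(1)] assms(1) by fastforce
  ultimately show ?thesis using n(1) unfolding cyclic_orders_def by blast
qed

end
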